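(* The numerical GCD problem is strongly well-posed; more specifically: for every polynomial pair $(\hat p,\hat q)\in\mathcal{P}_{m,n}$ there are a neighborhood $\mathcal{D}$ of $(\hat p,\hat q)$ in $P_{m,n}$, contained in $\mathcal{P}_{m,n}$, and a constant $\theta>0$ such that the following hold. (i) (Existence) For every $(p,q)\in\mathcal{D}$ and every $\varepsilon$ in the interval $(\|(p,q)-(\hat p,\hat q)\|,\theta)$, the numerical GCD $\gcd_\varepsilon(p,q)$ exists. (ii) (Uniqueness) For every such $(p,q)$ and $\varepsilon$, $\gcd_\varepsilon(p,q)$ is unique as a $\sim$-equivalence class. (iii) (Lipschitz continuity) For every $\varepsilon\in(0,\theta)$ there is a constant $\alpha>0$ such that, for all $(p_1,q_1),(p_2,q_2)\in\mathcal{D}$ with $\|(p_i,q_i)-(\hat p,\hat q)\|<\varepsilon$ for $i=1,2$, $$\|(u_1,v_1,w_1)-(u_2,v_2,w_2)\|\le\alpha\,\|(p_1,q_1)-(p_2,q_2)\|$$ for certain $u_1\in\gcd_\varepsilon(p_1,q_1)$ and $u_2\in\gcd_\varepsilon(p_2,q_2)$ with cofactor pairs $(v_1,w_1)$ and $(v_2,w_2)$ respectively.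
   Context: All polynomials are in $\mathbb{C}[x]$, one variable. $P_n$ is the vector space of polynomials of degree at most $n$; $\|p\|$ is the Euclidean norm of the coefficient vector of $p$, and $\|(p_1,\dots,p_l)\|=\sqrt{\|p_1\|^2+\cdots+\|p_l\|^2}$. $P_{m,n}=P_m\times P_n$ and $\mathcal{P}_{m,n}=\{(p,q)\in P_{m,n} : \deg p=m,\ \deg q=n\}$. A GCD of $(p,q)$ is any polynomial of highest degree dividing both (not necessarily monic); $\gcd(p,q)$ denotes the set of all GCDs, one equivalence class for the relation $f\sim g\iff f=\alpha g$ for some constant $\alpha\neq 0$. For $0\le k\le\min\{m,n\}$, $\mathcal{P}^k_{m,n}=\{(p,q)\in\mathcal{P}_{m,n} : \deg\gcd(p,q)=k\}$ and $\theta_k(p,q)=\inf\{\|(p,q)-(r,s)\| : (r,s)\in\mathcal{P}^k_{m,n}\}$. Numerical GCD: let $(p,q)\in\mathcal{P}_{m,n}$ and $\varepsilon>0$, and let $k=\max\{j : \theta_j(p,q)<\varepsilon\}$. A numerical GCD of $(p,q)$ within $\varepsilon$ is an exact GCD $u$ of a pair $(\tilde p,\tilde q)\in\mathcal{P}^k_{m,n}$ with $\|(\tilde p,\tilde q)-(p,q)\|=\theta_k(p,q)$. The $\sim$-class of numerical GCDs is denoted $\gcd_\varepsilon(p,q)$, so $\gcd_\varepsilon(p,q)=\gcd(\tilde p,\tilde q)$. The cofactor pair $(v,w)$ of a numerical GCD $u$ is $v=\tilde p/u$, $w=\tilde q/u$, so $(uv,uw)=(\tilde p,\tilde q)$. 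*)

theory Defs
  imports "HOL-Computational_Algebra.Polynomial" "HOL-Analysis.Analysis"
begin

text \<open>Pairs of polynomials are subtracted componentwise (instance from \<^theory>\<open>HOL-Library.Product_Plus\<close>).\<close>

definition poly_norm :: "complex poly \<Rightarrow> real" where
  "poly_norm p = sqrt (\<Sum>i\<le>degree p. (cmod (coeff p i))\<^sup>2)"

definition pair_norm :: "complex poly \<times> complex poly \<Rightarrow> real" where
  "pair_norm = (\<lambda>(p, q). sqrt ((poly_norm p)\<^sup>2 + (poly_norm q)\<^sup>2))"

definition triple_norm :: "complex poly \<times> complex poly \<times> complex poly \<Rightarrow> real" where
  "triple_norm = (\<lambda>(u, v, w). sqrt ((poly_norm u)\<^sup>2 + (poly_norm v)\<^sup>2 + (poly_norm w)\<^sup>2))"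

definition pairs_le :: "nat \<Rightarrow> nat \<Rightarrow> (complex poly \<times> complex poly) set" where
  "pairs_le m n = {(p, q). degree p \<le> m \<and> degree q \<le> n}"

text \<open>The zero polynomial does not have degree 0 in the mathematical sense, although
  \<open>degree 0 = 0\<close> in the library; hence the explicit exclusion of 0.\<close>

definition pairs_eq :: "nat \<Rightarrow> nat \<Rightarrow> (complex poly \<times> complex poly) set" where
  "pairs_eq m n = {(p, q). p \<noteq> 0 \<and> q \<noteq> 0 \<and> degree p = m \<and> degree q = n}"

definition nbhd_in_pairs ::
  "nat \<Rightarrow> nat \<Rightarrow> complex poly \<times> complex poly \<Rightarrow> (complex poly \<times> complex poly) set \<Rightarrow> bool" where
  "nbhd_in_pairs m n x D \<longleftrightarrow>
     D \<subseteq> pairs_le m n \<and> (\<exists>r>0. {y \<in> pairs_le m n. pair_norm (y - x) < r} \<subseteq> D)"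

definition poly_sim :: "complex poly \<Rightarrow> complex poly \<Rightarrow> bool" where
  "poly_sim f g \<longleftrightarrow> (\<exists>a. a \<noteq> 0 \<and> f = smult a g)"

text \<open>All GCDs, not only the monic one.\<close>

definition gcds :: "complex poly \<times> complex poly \<Rightarrow> complex poly set" where
  "gcds = (\<lambda>(p, q). {u. u dvd p \<and> u dvd q \<and>
     (\<forall>d. d dvd p \<and> d dvd q \<longrightarrow> degree d \<le> degree u)})"

definition gcd_stratum :: "nat \<Rightarrow> nat \<Rightarrow> nat \<Rightarrow> (complex poly \<times> complex poly) set" where
  "gcd_stratum m n k = {x \<in> pairs_eq m n. \<exists>u \<in> gcds x. degree u = k}"

definition stratum_dist :: "nat \<Rightarrow> nat \<Rightarrow> nat \<Rightarrow> complex poly \<times> complex poly \<Rightarrow> real" where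
  "stratum_dist m n k x = (INF y \<in> gcd_stratum m n k. pair_norm (x - y))"

definition num_gcd_degree :: "nat \<Rightarrow> nat \<Rightarrow> real \<Rightarrow> complex poly \<times> complex poly \<Rightarrow> nat" where
  "num_gcd_degree m n \<epsilon> x = Max {j. j \<le> min m n \<and> stratum_dist m n j x < \<epsilon>}"

definition nearest_pairs ::
  "nat \<Rightarrow> nat \<Rightarrow> real \<Rightarrow> complex poly \<times> complex poly \<Rightarrow> (complex poly \<times> complex poly) set" where
  "nearest_pairs m n \<epsilon> x = (let k = num_gcd_degree m n \<epsilon> x in
     {y \<in> gcd_stratum m n k. pair_norm (y - x) = stratum_dist m n k x})"

text \<open>The set of all numerical GCDs within \<open>\<epsilon>\<close>, over all nearest pairs. That it is nonempty and
  consists of a single class of \<open>poly_sim\<close> is not built into the definition.\<close>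

definition num_gcds ::
  "nat \<Rightarrow> nat \<Rightarrow> real \<Rightarrow> complex poly \<times> complex poly \<Rightarrow> complex poly set" where
  "num_gcds m n \<epsilon> x = (\<Union>y \<in> nearest_pairs m n \<epsilon> x. gcds y)"

text \<open>The divisions below are exact, since \<open>u\<close> divides both components of \<open>(p, q)\<close>.\<close>

definition cofactor_pairs ::
  "nat \<Rightarrow> nat \<Rightarrow> real \<Rightarrow> complex poly \<times> complex poly \<Rightarrow> complex poly \<Rightarrow>
   (complex poly \<times> complex poly) set" where
  "cofactor_pairs m n \<epsilon> x u =
     {(p div u, q div u) | p q. (p, q) \<in> nearest_pairs m n \<epsilon> x \<and> u \<in> gcds (p, q)}"

end

theory Submission
  imports Defs "HOL-Computational_Algebra.Field_as_Ring" "HOL-Computational_Algebra.Polynomial_Factorial"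
begin

text \<open>Why the theorem holds. Let \<open>k\<close> be the degree of the exact GCD of \<open>(p_hat, q_hat)\<close>. Close to this
  pair the pairs with GCD of degree \<open>k\<close> form a smooth submanifold of coefficient space, parametrised
  by \<open>(u, v, w) \<mapsto> (u v, u w)\<close> with \<open>u\<close> monic of degree \<open>k\<close>, and the numerical GCD of a nearby
  pair is read off from its nearest point on this submanifold. Nearest points of a submanifold exist
  locally, are unique and depend Lipschitz continuously on the given point.

  Two facts make this precise. The first is properness: since \<open>\<bar>u\<bar> \<bar>v\<bar> \<le> C \<bar>u v\<bar>\<close> for factors of
  bounded degree and since \<open>u\<close> is monic, the triples whose product stays close to a given pair of
  exact degrees \<open>m\<close> and \<open>n\<close> form a compact set (\<open>compact_pair_product_preimage\<close>). From this compactness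
  follow that pairs with a GCD of higher degree stay away from \<open>(p_hat, q_hat)\<close>
  (\<open>higher_strata_away\<close>), so that the numerical GCD has degree \<open>k\<close>; that nearest pairs exist
  (\<open>nearest_in_stratum_exists\<close>); and that a pair close to \<open>(p_hat, q_hat)\<close> has its factors close to
  those of \<open>(p_hat, q_hat)\<close> (\<open>triples_near\<close>).

  The second is that the derivative \<open>(a, b, c) \<mapsto> (u b + a v, u c + a w)\<close> of the product map is
  injective on directions with \<open>degree a < k\<close>, because the cofactors \<open>v\<close> and \<open>w\<close> are coprime
  (\<open>pair_product_deriv_lower_bound\<close>).

  Uniqueness and Lipschitz continuity then come out of one estimate (\<open>nearest_points_stable\<close>). Let
  \<open>y1\<close>, \<open>y2\<close> be nearest to \<open>x1\<close>, \<open>x2\<close>, with parameters \<open>z1\<close>, \<open>z2\<close>. Moving on the segment from one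
  parameter to the other cannot decrease the distance, so \<open>x1 - y1\<close> makes no acute angle with the
  derivative at \<open>z1\<close> in direction \<open>z2 - z1\<close>, and likewise with the roles exchanged. As the product
  map is quadratic, adding these two inequalities gives
  \<open>\<bar>z1 - z2\<bar> \<le> L \<bar>x1 - x2\<bar>\<close>, provided that all points lie close enough to \<open>(p_hat, q_hat)\<close>. Taking
  \<open>x1 = x2\<close> yields uniqueness.\<close>

section \<open>Polynomials as an inner product space\<close>

text \<open>A copy of the type of polynomials carries the Euclidean structure of the coefficient vectors:
  on polynomials themselves \<open>sgn\<close> already means the sign of the leading coefficient for ordered
  coefficient rings, while a normed space demands \<open>sgn x = x / \<bar>x\<bar>\<close>. Products of this type are
  again inner product spaces, and their norms are \<open>pair_norm\<close> and \<open>triple_norm\<close>.\<close>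

typedef cpoly = "UNIV :: complex poly set"
  morphisms poly_of vec_of ..

setup_lifting type_definition_cpoly

instantiation cpoly :: comm_ring
begin

lift_definition zero_cpoly :: cpoly is 0 .
lift_definition plus_cpoly :: "cpoly \<Rightarrow> cpoly \<Rightarrow> cpoly" is "(+)" .
lift_definition minus_cpoly :: "cpoly \<Rightarrow> cpoly \<Rightarrow> cpoly" is "(-)" .
lift_definition uminus_cpoly :: "cpoly \<Rightarrow> cpoly" is "uminus" .
lift_definition times_cpoly :: "cpoly \<Rightarrow> cpoly \<Rightarrow> cpoly" is "(*)" .

instance
  by standard (transfer; simp add: algebra_simps)+

end

lemmas poly_of_ring_simps [simp] =
  zero_cpoly.rep_eq plus_cpoly.rep_eq minus_cpoly.rep_eq uminus_cpoly.rep_eq times_cpoly.rep_eq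

lemma poly_of_eq_0_iff [simp]: "poly_of x = 0 \<longleftrightarrow> x = 0"
  by transfer simp

lemma poly_of_vec_of [simp]: "poly_of (vec_of p) = p"
  by (simp add: vec_of_inverse)

definition coeff_inner :: "complex poly \<Rightarrow> complex poly \<Rightarrow> real" where
  "coeff_inner p q = (\<Sum>i\<le>max (degree p) (degree q). coeff p i \<bullet> coeff q i)"

lemma coeff_inner_bound:
  assumes "degree p \<le> N" "degree q \<le> N"
  shows "coeff_inner p q = (\<Sum>i\<le>N. coeff p i \<bullet> coeff q i)"
  unfolding coeff_inner_def
proof (rule sum.mono_neutral_left)
  show "\<forall>i\<in>{..N} - {..max (degree p) (degree q)}. coeff p i \<bullet> coeff q i = 0"
    by (auto simp: coeff_eq_0 not_le le_max_iff_disj)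
qed (use assms in auto)

lemma poly_norm_eq_coeff_inner: "poly_norm p = sqrt (coeff_inner p p)"
  by (simp add: poly_norm_def coeff_inner_def power2_norm_eq_inner)

instantiation cpoly :: real_vector
begin

lift_definition scaleR_cpoly :: "real \<Rightarrow> cpoly \<Rightarrow> cpoly" is "\<lambda>r. smult (of_real r)" .

instance
  by standard (transfer; simp add: smult_add_right smult_add_left)+

end

instantiation cpoly :: real_inner
begin

lift_definition inner_cpoly :: "cpoly \<Rightarrow> cpoly \<Rightarrow> real" is coeff_inner .
lift_definition norm_cpoly :: "cpoly \<Rightarrow> real" is poly_norm .

definition sgn_cpoly :: "cpoly \<Rightarrow> cpoly" where "sgn_cpoly x = x /\<^sub>R norm x"
definition dist_cpoly :: "cpoly \<Rightarrow> cpoly \<Rightarrow> real" where "dist_cpoly x y = norm (x - y)"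
definition uniformity_cpoly :: "(cpoly \<times> cpoly) filter" where
  "uniformity_cpoly = (INF e\<in>{0 <..}. principal {(x, y). dist x y < e})"
definition open_cpoly :: "cpoly set \<Rightarrow> bool" where
  "open_cpoly U \<longleftrightarrow> (\<forall>x\<in>U. eventually (\<lambda>(x', y). x' = x \<longrightarrow> y \<in> U) uniformity)"

instance
proof
  fix x y z :: cpoly and a :: real
  show "dist x y = norm (x - y)" by (rule dist_cpoly_def)
  show "sgn x = x /\<^sub>R norm x" by (rule sgn_cpoly_def)
  show "uniformity = (INF e\<in>{0 <..}. principal {(x, y :: cpoly). dist x y < e})"
    by (rule uniformity_cpoly_def)
  show "open U \<longleftrightarrow> (\<forall>x\<in>U. \<forall>\<^sub>F (x', y) in uniformity. x' = x \<longrightarrow> y \<in> U)" for U :: "cpoly set"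
    by (rule open_cpoly_def)
  show "inner x y = inner y x"
    by transfer (simp add: coeff_inner_def inner_commute max.commute)
  show "inner (x + y) z = inner x z + inner y z"
  proof transfer
    fix p q r :: "complex poly"
    let ?N = "max (max (degree p) (degree q)) (degree r)"
    have "degree (p + q) \<le> ?N" by (simp add: degree_add_le)
    then show "coeff_inner (p + q) r = coeff_inner p r + coeff_inner q r"
      by (simp add: coeff_inner_bound [where N = ?N] inner_add_left sum.distrib)
  qed
  show "inner (a *\<^sub>R x) y = a * inner x y"
  proof transfer
    fix a :: real and p q :: "complex poly"
    let ?N = "max (degree p) (degree q)"
    have "degree (smult (of_real a) p) \<le> ?N" by (simp add: degree_smult_eq)
    moreover have "(complex_of_real a * s) \<bullet> t = a * (s \<bullet> t)" for s t
      by (simp add: inner_complex_def algebra_simps)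
    ultimately show "coeff_inner (smult (of_real a) p) q = a * coeff_inner p q"
      by (simp add: coeff_inner_bound [where N = ?N] sum_distrib_left)
  qed
  show "0 \<le> inner x x"
    by transfer (simp add: coeff_inner_def sum_nonneg)
  show "inner x x = 0 \<longleftrightarrow> x = 0"
  proof transfer
    fix p :: "complex poly"
    have "coeff_inner p p = 0 \<longleftrightarrow> (\<forall>i\<le>degree p. coeff p i = 0)"
      by (simp add: coeff_inner_def sum_nonneg_eq_0_iff Ball_def)
    also have "\<dots> \<longleftrightarrow> p = 0"
      by (metis coeff_0 le_refl leading_coeff_0_iff)
    finally show "coeff_inner p p = 0 \<longleftrightarrow> p = 0" .
  qed
  show "norm x = sqrt (inner x x)"
    by transfer (rule poly_norm_eq_coeff_inner)
qed

end

lemma poly_of_scaleR [simp]: "poly_of (r *\<^sub>R x) = smult (of_real r) (poly_of x)"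
  by (rule scaleR_cpoly.rep_eq)

lemma scaleR_mult_cpoly:
  fixes x y :: cpoly
  shows "(r *\<^sub>R x) * y = r *\<^sub>R (x * y)" "x * (r *\<^sub>R y) = r *\<^sub>R (x * y)"
  by (transfer, simp)+

lemma norm_vec_of: "norm (vec_of p) = poly_norm p"
  by (simp add: norm_cpoly.rep_eq)

lemma norm_coeff_le: "norm (coeff (poly_of x) i) \<le> norm x"
proof (cases "i \<le> degree (poly_of x)")
  case True
  then have "(norm (coeff (poly_of x) i))\<^sup>2 \<le> (\<Sum>i\<le>degree (poly_of x). (cmod (coeff (poly_of x) i))\<^sup>2)"
    by (intro member_le_sum) auto
  then show ?thesis
    by (simp add: norm_cpoly.rep_eq poly_norm_def real_le_rsqrt)
qed (simp add: coeff_eq_0)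

lemma bounded_linear_coeff: "bounded_linear (\<lambda>x. coeff (poly_of x) i)"
  by (rule bounded_linear_intro [where K = 1]) (auto simp: norm_coeff_le scaleR_conv_of_real)

lemmas continuous_on_coeff [continuous_intros] =
  bounded_linear.continuous_on [OF bounded_linear_coeff]

lemma norm_vec_pCons:
  "norm (vec_of (pCons a p)) = sqrt ((norm a)\<^sup>2 + (norm (vec_of p))\<^sup>2)"
proof (cases "p = 0")
  case True
  then show ?thesis by (cases "a = 0") (auto simp: norm_vec_of poly_norm_def)
next
  case False
  then show ?thesis
    by (simp add: norm_vec_of poly_norm_def sum.atMost_Suc_shift sum_nonneg del: sum.atMost_Suc)
qed

lemma vec_of_add: "vec_of (p + q) = vec_of p + vec_of q"
  and vec_of_diff: "vec_of (p - q) = vec_of p - vec_of q"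
  and vec_of_mult: "vec_of (p * q) = vec_of p * vec_of q"
  and vec_of_0: "vec_of 0 = 0"
  by (simp_all add: plus_cpoly.abs_eq minus_cpoly.abs_eq times_cpoly.abs_eq zero_cpoly_def eq_onp_def)

lemma norm_vec_smult: "norm (vec_of (smult a p)) = norm a * norm (vec_of p)"
proof (cases "a = 0")
  case False
  have "(\<Sum>i\<le>degree p. (cmod (a * coeff p i))\<^sup>2) = (norm a)\<^sup>2 * (\<Sum>i\<le>degree p. (cmod (coeff p i))\<^sup>2)"
    by (simp add: norm_mult power_mult_distrib sum_distrib_left)
  with False show ?thesis
    by (simp add: norm_vec_of poly_norm_def real_sqrt_mult)
qed (simp add: vec_of_0)

text \<open>Multiplication is not bounded on the whole space. For a factor of bounded degree, however,
  \<open>x y\<close> is a sum of boundedly many shifts of \<open>y\<close>, each scaled by a coefficient of \<open>x\<close>.\<close>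
lemma norm_mult_bounded_degree:
  assumes "degree (poly_of x) \<le> N"
  shows "norm (x * y) \<le> real (Suc N) * norm x * norm y"
proof -
  have *: "norm (vec_of (p * q)) \<le> (\<Sum>i\<le>degree p. norm (coeff p i)) * norm (vec_of q)" for p q
  proof (induction p)
    case 0
    then show ?case by (simp add: vec_of_0)
  next
    case (pCons a p)
    have "norm (vec_of (pCons a p * q)) \<le> norm (vec_of (smult a q)) + norm (vec_of (pCons 0 (p * q)))"
      by (simp add: vec_of_add norm_triangle_ineq)
    also have "\<dots> \<le> norm a * norm (vec_of q) + (\<Sum>i\<le>degree p. norm (coeff p i)) * norm (vec_of q)"
      using pCons.IH by (simp add: norm_vec_smult norm_vec_pCons)
    also have "\<dots> = (\<Sum>i\<le>degree (pCons a p). norm (coeff (pCons a p) i)) * norm (vec_of q)"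
      by (cases "p = 0") (simp_all add: sum.atMost_Suc_shift distrib_right del: sum.atMost_Suc)
    finally show ?case .
  qed
  have "(\<Sum>i\<le>degree (poly_of x). norm (coeff (poly_of x) i)) \<le> (\<Sum>i\<le>degree (poly_of x). norm x)"
    by (intro sum_mono norm_coeff_le)
  also have "\<dots> \<le> real (Suc N) * norm x"
    using assms by (auto intro!: mult_right_mono)
  finally have "(\<Sum>i\<le>degree (poly_of x). norm (coeff (poly_of x) i)) * norm y \<le> real (Suc N) * norm x * norm y"
    by (intro mult_right_mono) auto
  with * [of "poly_of x" "poly_of y"] show ?thesis
    by (simp add: vec_of_mult poly_of_inverse)
qed

section \<open>Compactness in bounded degree\<close>
definition polys_le :: "nat \<Rightarrow> cpoly set" where
  "polys_le N = {x. degree (poly_of x) \<le> N}"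

lemma subspace_polys_le: "subspace (polys_le N)"
  by (auto simp: subspace_def polys_le_def degree_add_le degree_smult_eq)

lemma mem_polys_le [simp]: "x \<in> polys_le N \<longleftrightarrow> degree (poly_of x) \<le> N"
  by (simp add: polys_le_def)

lemma continuous_on_mult_polys_le:
  fixes f g :: "'a::topological_space \<Rightarrow> cpoly"
  assumes f: "continuous_on S f" and g: "continuous_on S g" and deg: "\<And>x. x \<in> S \<Longrightarrow> f x \<in> polys_le N"
  shows "continuous_on S (\<lambda>x. f x * g x)"
  unfolding continuous_on_def
proof
  fix a assume a: "a \<in> S"
  let ?F = "at a within S"
  have S: "\<forall>\<^sub>F x in ?F. x \<in> S"
    by (simp add: eventually_at_filter)
  have lim: "(f \<longlongrightarrow> f a) ?F" "(g \<longlongrightarrow> g a) ?F"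
    using f g a by (auto simp: continuous_on_def)
  have "((\<lambda>x. real (Suc N) * norm (f x - f a) * norm (g x) + real (Suc N) * norm (f a) * norm (g x - g a))
      \<longlongrightarrow> real (Suc N) * norm (f a - f a) * norm (g a) + real (Suc N) * norm (f a) * norm (g a - g a)) ?F"
    by (intro tendsto_intros lim)
  then have "((\<lambda>x. real (Suc N) * norm (f x - f a) * norm (g x) + real (Suc N) * norm (f a) * norm (g x - g a))
      \<longlongrightarrow> 0) ?F" by simp
  moreover have "\<forall>\<^sub>F x in ?F. norm (f x * g x - f a * g a) \<le>
      real (Suc N) * norm (f x - f a) * norm (g x) + real (Suc N) * norm (f a) * norm (g x - g a)"
    using S
  proof eventually_elim
    case (elim x)
    have "f x * g x - f a * g a = (f x - f a) * g x + f a * (g x - g a)"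
      by (simp add: algebra_simps)
    also have "norm \<dots> \<le> norm ((f x - f a) * g x) + norm (f a * (g x - g a))"
      by (rule norm_triangle_ineq)
    also have "\<dots> \<le> real (Suc N) * norm (f x - f a) * norm (g x) + real (Suc N) * norm (f a) * norm (g x - g a)"
      using deg [OF elim] deg [OF a] by (intro add_mono norm_mult_bounded_degree) (auto intro: degree_diff_le)
    finally show ?case .
  qed
  ultimately have "((\<lambda>x. f x * g x - f a * g a) \<longlongrightarrow> 0) ?F"
    by (rule Lim_null_comparison [rotated])
  then show "((\<lambda>x. f x * g x) \<longlongrightarrow> f a * g a) ?F"
    by (rule LIM_zero_cancel)
qed

text \<open>Prepending a constant coefficient is an isometry of \<open>\<complex> \<times> polys_le N\<close> onto
  \<open>polys_le (Suc N)\<close>, so compactness of coefficient cubes passes from one degree to the next.\<close>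

lemma compact_polys_le_coeffs:
  "compact {x \<in> polys_le N. \<forall>i. norm (coeff (poly_of x) i) \<le> R}"
proof (induction N)
  case 0
  have "dist (vec_of [:a:]) (vec_of [:b:]) = dist a b" for a b
    by (simp add: dist_norm flip: vec_of_diff) (simp add: norm_vec_pCons vec_of_0)
  then have "continuous_on (cball 0 R) (\<lambda>a. vec_of [:a:])"
    by (auto simp: continuous_on_iff)
  then have "compact ((\<lambda>a. vec_of [:a:]) ` cball 0 R)"
    by (rule compact_continuous_image) simp
  moreover have "(\<lambda>a. vec_of [:a:]) ` cball 0 R = {x \<in> polys_le 0. \<forall>i. norm (coeff (poly_of x) i) \<le> R}"
  proof (intro equalityI subsetI)
    fix x assume "x \<in> {x \<in> polys_le 0. \<forall>i. norm (coeff (poly_of x) i) \<le> R}"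
    then have "x = vec_of [:coeff (poly_of x) 0:]" "norm (coeff (poly_of x) 0) \<le> R"
      by (auto simp: degree_0_id poly_of_inverse)
    then show "x \<in> (\<lambda>a. vec_of [:a:]) ` cball 0 R" by auto
  qed (auto simp: coeff_pCons split: nat.split intro: order_trans [OF norm_ge_zero])
  ultimately show ?case by simp
next
  case (Suc N)
  let ?K = "\<lambda>N. {x \<in> polys_le N. \<forall>i. norm (coeff (poly_of x) i) \<le> R}"
  let ?f = "\<lambda>(a, x). vec_of (pCons a (poly_of x))"
  have "dist (?f y) (?f z) = dist y z" for y z
    by (cases y; cases z)
       (simp add: dist_norm norm_vec_pCons norm_prod_def minus_cpoly.rep_eq poly_of_inverse
         flip: vec_of_diff poly_of_ring_simps)
  then have "continuous_on (cball 0 R \<times> ?K N) ?f"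
    unfolding continuous_on_iff by metis
  then have "compact (?f ` (cball 0 R \<times> ?K N))"
    by (rule compact_continuous_image) (intro compact_Times compact_cball Suc)
  moreover have "?f ` (cball 0 R \<times> ?K N) = ?K (Suc N)"
  proof (intro equalityI subsetI)
    fix x assume x: "x \<in> ?K (Suc N)"
    obtain a p where p: "poly_of x = pCons a p"
      by (cases "poly_of x") auto
    have "degree p \<le> N"
      using x p by (cases "p = 0") auto
    moreover have "norm a \<le> R" "norm (coeff p i) \<le> R" for i
      using x p by (auto dest: spec [of _ 0]) (auto dest: spec [of _ "Suc i"])
    moreover have "x = ?f (a, vec_of p)"
      by (simp add: poly_of_inverse flip: p)
    ultimately show "x \<in> ?f ` (cball 0 R \<times> ?K N)"
      by (intro image_eqI [where x = "(a, vec_of p)"]) auto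
  next
    fix x assume "x \<in> ?f ` (cball 0 R \<times> ?K N)"
    then show "x \<in> ?K (Suc N)"
      by (auto simp: coeff_pCons degree_pCons_le split: nat.split intro: order_trans [OF degree_pCons_le])
  qed
  ultimately show ?case by simp
qed

lemma closed_polys_le: "closed (polys_le N)"
proof -
  have "polys_le N = (\<Inter>i\<in>{N<..}. {x. coeff (poly_of x) i = 0})"
    by (auto simp: coeff_eq_0 intro!: degree_le)
  moreover have "closed {x. coeff (poly_of x) i = 0}" for i
    by (intro closed_Collect_eq continuous_intros)
  ultimately show ?thesis by auto
qed

lemma compact_polys_le:
  assumes "S \<subseteq> polys_le N" "closed S" "bounded S"
  shows "compact S"
proof -
  obtain R where "\<And>x. x \<in> S \<Longrightarrow> norm x \<le> R"
    using assms(3) by (auto simp: bounded_iff)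
  then have "S \<subseteq> {x \<in> polys_le N. \<forall>i. norm (coeff (poly_of x) i) \<le> R}"
    using assms(1) by (auto intro: order_trans [OF norm_coeff_le])
  then show ?thesis
    using compact_Int_closed [OF compact_polys_le_coeffs [of N R] assms(2)] by (simp only: Int_absorb1)
qed

lemma closed_unit_sphere: "closed (sphere (0 :: 'a::real_normed_vector) 1)"
  by (simp add: sphere_def closed_Collect_eq continuous_on_const continuous_on_norm continuous_on_id)

lemma bounded_unit_sphere: "bounded (sphere (0 :: 'a::real_normed_vector) 1)"
  by (rule bounded_subset [OF bounded_cball sphere_cball])

text \<open>On the compact unit sphere the norm of the map attains a minimum, which is not 0;
  homogeneity carries the bound to all lengths.\<close>
lemma homogeneous_lower_bound:
  fixes f :: "'a::real_normed_vector \<Rightarrow> 'b::real_normed_vector"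
  assumes T: "subspace T" "compact (T \<inter> sphere 0 1)" "continuous_on T f"
    and hom: "\<And>r x. x \<in> T \<Longrightarrow> f (r *\<^sub>R x) = r *\<^sub>R f x"
    and nz: "\<And>x. x \<in> T \<Longrightarrow> f x = 0 \<Longrightarrow> x = 0"
  obtains c where "c > 0" "\<And>x. x \<in> T \<Longrightarrow> c * norm x \<le> norm (f x)"
proof (cases "T \<inter> sphere 0 1 = {}")
  case True
  have 0: "x = 0" if "x \<in> T" for x
  proof (rule ccontr)
    assume "x \<noteq> 0"
    then have "inverse (norm x) *\<^sub>R x \<in> T \<inter> sphere 0 1"
      using T(1) that by (auto intro: subspace_scale)
    with True show False by blast
  qed
  show ?thesis
  proof (rule that [of 1])
    show "1 * norm x \<le> norm (f x)" if "x \<in> T" for x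
      using 0 [OF that] by simp
  qed simp
next
  case False
  have "continuous_on (T \<inter> sphere 0 1) (\<lambda>x. norm (f x))"
    using T(3) by (intro continuous_intros) (auto intro: continuous_on_subset)
  then obtain e where e: "e \<in> T \<inter> sphere 0 1" "\<And>x. x \<in> T \<inter> sphere 0 1 \<Longrightarrow> norm (f e) \<le> norm (f x)"
    using continuous_attains_inf [OF T(2) False] by blast
  show ?thesis
  proof (rule that [of "norm (f e)"])
    show "norm (f e) > 0" using e(1) nz [of e] by auto
  next
    fix x assume x: "x \<in> T"
    show "norm (f e) * norm x \<le> norm (f x)"
    proof (cases "x = 0")
      case False
      then have "inverse (norm x) *\<^sub>R x \<in> T \<inter> sphere 0 1"
        using T(1) x by (auto intro: subspace_scale)
      from e(2) [OF this] have "norm (f e) \<le> norm (f x) / norm x"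
        using hom [OF x] by (simp add: divide_inverse mult.commute)
      with False show ?thesis by (simp add: field_simps)
    qed simp
  qed
qed

text \<open>There are no zero divisors, so the product of two unit vectors of bounded degree has norm
  bounded below, by compactness of the two unit spheres.\<close>
lemma mult_lower_bound:
  obtains c where "c > 0"
    "\<And>u v. u \<in> polys_le a \<Longrightarrow> v \<in> polys_le b \<Longrightarrow> c * norm u * norm v \<le> norm (u * v)"
proof -
  let ?S = "\<lambda>N. polys_le N \<inter> sphere (0 :: cpoly) 1"
  let ?K = "?S a \<times> ?S b"
  have cpt: "compact (?S N)" for N
    by (rule compact_polys_le [OF Int_lower1 closed_Int [OF closed_polys_le closed_unit_sphere]
          bounded_subset [OF bounded_unit_sphere Int_lower2]])
  have "vec_of 1 \<in> ?S N" for N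
    by (simp add: norm_vec_of poly_norm_def)
  then have ne: "?K \<noteq> {}" by blast
  have "continuous_on ?K (\<lambda>y. norm (fst y * snd y))"
    by (rule continuous_on_norm, rule continuous_on_mult_polys_le [where N = a])
       (auto simp: continuous_on_fst continuous_on_snd)
  then obtain e where e: "e \<in> ?K" "\<And>y. y \<in> ?K \<Longrightarrow> norm (fst e * snd e) \<le> norm (fst y * snd y)"
    using continuous_attains_inf [OF compact_Times [OF cpt cpt] ne] by blast
  show ?thesis
  proof (rule that [of "norm (fst e * snd e)"])
    have "poly_of (fst e) \<noteq> 0" "poly_of (snd e) \<noteq> 0"
      using e(1) by auto
    then have "poly_of (fst e * snd e) \<noteq> 0"
      unfolding poly_of_ring_simps by (rule no_zero_divisors)
    then show "norm (fst e * snd e) > 0"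
      by (simp only: poly_of_eq_0_iff zero_less_norm_iff not_False_eq_True)
  next
    fix u v assume uv: "u \<in> polys_le a" "v \<in> polys_le b"
    show "norm (fst e * snd e) * norm u * norm v \<le> norm (u * v)"
    proof (cases "u = 0 \<or> v = 0")
      case False
      then have "(inverse (norm u) *\<^sub>R u, inverse (norm v) *\<^sub>R v) \<in> ?K"
        using uv by (auto intro: order_trans [OF degree_smult_le])
      from e(2) [OF this] have "norm (fst e * snd e) \<le> norm (u * v) / (norm u * norm v)"
        by (simp add: scaleR_mult_cpoly field_simps)
      with False show ?thesis by (simp add: field_simps)
    qed auto
  qed
qed

section \<open>The product map on triples\<close>

text \<open>The leading coefficient of \<open>u\<close> is fixed to remove the scaling freedom
  \<open>(u, v, w) \<mapsto> (a u, v / a, w / a)\<close>. This makes an affine space,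
  whose difference vectors are the tangent triples.\<close>
definition monic_triples :: "nat \<Rightarrow> nat \<Rightarrow> nat \<Rightarrow> (cpoly \<times> cpoly \<times> cpoly) set" where
  "monic_triples m n k = {u \<in> polys_le k. coeff (poly_of u) k = 1} \<times> polys_le (m - k) \<times> polys_le (n - k)"

definition tangent_triples :: "nat \<Rightarrow> nat \<Rightarrow> nat \<Rightarrow> (cpoly \<times> cpoly \<times> cpoly) set" where
  "tangent_triples m n k = {u \<in> polys_le k. coeff (poly_of u) k = 0} \<times> polys_le (m - k) \<times> polys_le (n - k)"

fun pair_product :: "cpoly \<times> cpoly \<times> cpoly \<Rightarrow> cpoly \<times> cpoly" where
  "pair_product (u, v, w) = (u * v, u * w)"

fun pair_product_deriv :: "cpoly \<times> cpoly \<times> cpoly \<Rightarrow> cpoly \<times> cpoly \<times> cpoly \<Rightarrow> cpoly \<times> cpoly" where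
  "pair_product_deriv (u, v, w) (a, b, c) = (u * b + a * v, u * c + a * w)"

lemma pair_product_eq: "pair_product = (\<lambda>z. (fst z * fst (snd z), fst z * snd (snd z)))"
  by auto

lemma pair_product_deriv_eq:
  "pair_product_deriv z d =
     (fst z * fst (snd d) + fst d * fst (snd z), fst z * snd (snd d) + fst d * snd (snd z))"
  by (cases z; cases d) auto

text \<open>The product map is a quadratic form, so its Taylor expansion stops here; the remainder is
  again a value of the map. The bilinear derivative is the polarisation of the form.\<close>
lemma pair_product_add:
  "pair_product (z + d) = pair_product z + pair_product_deriv z d + pair_product d"
  by (cases z; cases d) (simp add: algebra_simps)

lemma pair_product_scaleR: "pair_product (r *\<^sub>R z) = r\<^sup>2 *\<^sub>R pair_product z"
  by (cases z) (simp add: scaleR_mult_cpoly power2_eq_square)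

lemma pair_product_deriv_scaleR:
  "pair_product_deriv z (r *\<^sub>R d) = r *\<^sub>R pair_product_deriv z d"
  by (cases z; cases d) (simp add: scaleR_mult_cpoly algebra_simps)

lemma pair_product_deriv_diff:
  "pair_product_deriv z' d - pair_product_deriv z d = pair_product_deriv (z' - z) d"
  by (cases z; cases d; cases z') (simp add: algebra_simps)

lemma pair_product_deriv_self: "pair_product_deriv d d = 2 *\<^sub>R pair_product d"
  by (cases d) (simp add: algebra_simps scaleR_2)

lemma pair_product_deriv_uminus: "pair_product_deriv z (- d) = - pair_product_deriv z d"
  by (cases z; cases d) (simp add: algebra_simps)

lemma convex_monic_triples: "convex (monic_triples m n k)"
proof -
  have "convex {u \<in> polys_le k. coeff (poly_of u) k = 1}"
  proof (rule convexI)
    fix x y :: cpoly and s t :: real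
    assume *: "x \<in> {u \<in> polys_le k. coeff (poly_of u) k = 1}" "y \<in> {u \<in> polys_le k. coeff (poly_of u) k = 1}"
      "0 \<le> s" "0 \<le> t" "s + t = 1"
    moreover have "complex_of_real s + complex_of_real t = 1"
      using * by (metis of_real_1 of_real_add)
    moreover have "s *\<^sub>R x + t *\<^sub>R y \<in> polys_le k"
      using * by (intro subspace_add subspace_scale subspace_polys_le) auto
    ultimately show "s *\<^sub>R x + t *\<^sub>R y \<in> {u \<in> polys_le k. coeff (poly_of u) k = 1}"
      by simp
  qed
  then show ?thesis
    unfolding monic_triples_def
    by (intro convex_Times subspace_polys_le [THEN subspace_imp_convex])
qed

lemma monic_triplesD:
  assumes "(u, v, w) \<in> monic_triples m n k"
  shows "degree (poly_of u) = k" "u \<noteq> 0"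
proof -
  have u: "degree (poly_of u) \<le> k" "coeff (poly_of u) k = 1"
    using assms by (auto simp: monic_triples_def)
  then show "degree (poly_of u) = k"
    by (intro antisym le_degree) auto
  show "u \<noteq> 0" using u(2) by auto
qed

lemma monic_triples_diff:
  "z \<in> monic_triples m n k \<Longrightarrow> z' \<in> monic_triples m n k \<Longrightarrow> z - z' \<in> tangent_triples m n k"
  by (auto simp: monic_triples_def tangent_triples_def degree_diff_le)

lemma subspace_tangent_triples: "subspace (tangent_triples m n k)"
proof -
  have "subspace {u \<in> polys_le k. coeff (poly_of u) k = 0}"
    by (auto simp: subspace_def degree_add_le intro: order_trans [OF degree_smult_le])
  then show ?thesis
    unfolding tangent_triples_def by (intro subspace_Times subspace_polys_le)
qed

lemma closed_monic_triples: "closed (monic_triples m n k)"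
  and closed_tangent_triples: "closed (tangent_triples m n k)"
proof -
  have "closed {u. coeff (poly_of u) k = a}" for a
    by (intro closed_Collect_eq continuous_intros)
  then have "closed (polys_le k \<inter> {u. coeff (poly_of u) k = a})" for a
    by (intro closed_Int closed_polys_le)
  then show "closed (monic_triples m n k)" "closed (tangent_triples m n k)"
    unfolding monic_triples_def tangent_triples_def Collect_conj_eq Collect_mem_eq
    by (intro closed_Times closed_polys_le; simp)+
qed

lemma compact_triples:
  assumes "S \<subseteq> polys_le a \<times> polys_le b \<times> polys_le c" "closed S" "bounded S"
  shows "compact S"
proof -
  obtain R where R: "\<And>x. x \<in> S \<Longrightarrow> norm x \<le> R"
    using assms(3) by (auto simp: bounded_iff)
  have "compact (polys_le N \<inter> cball 0 R)" for N
    by (rule compact_polys_le [OF Int_lower1 closed_Int [OF closed_polys_le closed_cball]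
          bounded_subset [OF bounded_cball Int_lower2]])
  then have cpt: "compact ((polys_le a \<inter> cball 0 R) \<times> (polys_le b \<inter> cball 0 R) \<times> (polys_le c \<inter> cball 0 R))"
    by (intro compact_Times)
  have "S \<subseteq> (polys_le a \<inter> cball 0 R) \<times> (polys_le b \<inter> cball 0 R) \<times> (polys_le c \<inter> cball 0 R)"
  proof
    fix x assume x: "x \<in> S"
    have "norm (fst x) \<le> R" "norm (fst (snd x)) \<le> R" "norm (snd (snd x)) \<le> R"
      using R [OF x] norm_fst_le [of "fst x" "snd x"] norm_snd_le [of "snd x" "fst x"]
        norm_fst_le [of "fst (snd x)" "snd (snd x)"] norm_snd_le [of "snd (snd x)" "fst (snd x)"] by auto
    with x assms(1) show "x \<in> (polys_le a \<inter> cball 0 R) \<times> (polys_le b \<inter> cball 0 R) \<times> (polys_le c \<inter> cball 0 R)"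
      by (auto simp del: mem_polys_le)
  qed
  then show ?thesis
    using compact_Int_closed [OF cpt assms(2)] by (simp add: Int_absorb1)
qed

lemma continuous_on_pair_product: "continuous_on (monic_triples m n k) pair_product"
proof -
  have "continuous_on (monic_triples m n k) (\<lambda>z. fst z * fst (snd z))"
    by (rule continuous_on_mult_polys_le [where N = k])
       (simp_all add: continuous_on_fst continuous_on_snd continuous_on_id mem_Times_iff monic_triples_def)
  moreover have "continuous_on (monic_triples m n k) (\<lambda>z. fst z * snd (snd z))"
    by (rule continuous_on_mult_polys_le [where N = k])
       (simp_all add: continuous_on_fst continuous_on_snd continuous_on_id mem_Times_iff monic_triples_def)
  ultimately show ?thesis
    unfolding pair_product_eq by (rule continuous_on_Pair)
qed

lemma coeff_mult_top:
  assumes "degree p \<le> a" "degree q \<le> b"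
  shows "coeff (p * q) (a + b) = coeff p a * coeff q b"
proof (cases "degree p = a \<and> degree q = b")
  case True
  then show ?thesis using coeff_mult_degree_sum [of p q] by auto
next
  case False
  then have "degree p + degree q < a + b" "coeff p a = 0 \<or> coeff q b = 0"
    using assms by (auto intro!: coeff_eq_0)
  moreover have "degree (p * q) \<le> degree p + degree q"
    by (rule degree_mult_le)
  ultimately show ?thesis by (auto simp: coeff_eq_0)
qed

text \<open>Properness of the product map. The bound on \<open>\<rho>\<close> keeps the leading coefficient of the first
  product away from 0. For monic \<open>u\<close> this is the coefficient of \<open>v\<close> at \<open>m - k\<close>, so \<open>\<bar>v\<bar>\<close> is bounded below and
  \<open>\<bar>u\<bar>\<close> above; conversely \<open>\<bar>u\<bar> \<ge> 1\<close> bounds \<open>\<bar>v\<bar>\<close> and \<open>\<bar>w\<bar>\<close> above.\<close>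
lemma compact_pair_product_preimage:
  fixes y :: "cpoly \<times> cpoly"
  assumes k: "k \<le> m" and \<rho>: "\<rho> < norm (coeff (poly_of (fst y)) m)"
  shows "compact {z \<in> monic_triples m n k. pair_product z \<in> cball y \<rho>}"
proof (rule compact_triples)
  let ?X = "{z \<in> monic_triples m n k. pair_product z \<in> cball y \<rho>}"
  show "?X \<subseteq> polys_le k \<times> polys_le (m - k) \<times> polys_le (n - k)"
    by (auto simp: monic_triples_def)
  have "closed (monic_triples m n k \<inter> pair_product -` cball y \<rho>)"
    by (intro continuous_closed_preimage continuous_on_pair_product closed_monic_triples closed_cball)
  then show "closed ?X"
    by (simp add: vimage_def Collect_conj_eq)
  obtain c1 where c1: "c1 > 0"
    "\<And>u v. u \<in> polys_le k \<Longrightarrow> v \<in> polys_le (m - k) \<Longrightarrow> c1 * norm u * norm v \<le> norm (u * v)"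
    using mult_lower_bound by blast
  obtain c2 where c2: "c2 > 0"
    "\<And>u v. u \<in> polys_le k \<Longrightarrow> v \<in> polys_le (n - k) \<Longrightarrow> c2 * norm u * norm v \<le> norm (u * v)"
    using mult_lower_bound by blast
  define e where "e = norm (coeff (poly_of (fst y)) m) - \<rho>"
  have e: "e > 0" using \<rho> by (simp add: e_def)
  define B where "B = norm y + \<rho>"
  have "norm z \<le> B / (c1 * e) + (B / c1 + B / c2)" if z: "z \<in> ?X" for z
  proof -
    obtain u v w where uvw: "z = (u, v, w)" by (cases z)
    have M: "u \<in> polys_le k" "coeff (poly_of u) k = 1" "v \<in> polys_le (m - k)" "w \<in> polys_le (n - k)"
      using z by (auto simp: uvw monic_triples_def)
    have F: "norm (y - (u * v, u * w)) \<le> \<rho>"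
      using z by (simp add: uvw dist_norm)
    have "norm (u * v, u * w) \<le> B"
      unfolding B_def using F norm_triangle_sub [of "(u * v, u * w)" y] by (simp add: norm_minus_commute)
    then have B: "norm (u * v) \<le> B" "norm (u * w) \<le> B"
      using norm_fst_le [of "u * v" "u * w"] norm_snd_le [of "u * w" "u * v"] by linarith+
    have u1: "1 \<le> norm u"
      using norm_coeff_le [of u k] M by simp
    have "coeff (poly_of (u * v)) m = coeff (poly_of v) (m - k)"
      using M k coeff_mult_top [of "poly_of u" k "poly_of v" "m - k"] by simp
    moreover have "norm (coeff (poly_of (fst y - u * v)) m) \<le> \<rho>"
      using F norm_fst_le [of "fst y - u * v" "snd y - u * w"] norm_coeff_le [of "fst y - u * v" m]
      by (metis (no_types) order_trans minus_prod_def fst_conv snd_conv)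
    then have "norm (coeff (poly_of (fst y)) m - coeff (poly_of (u * v)) m) \<le> \<rho>"
      by simp
    ultimately have "e \<le> norm (coeff (poly_of v) (m - k))"
      using norm_triangle_ineq2 [of "coeff (poly_of (fst y)) m" "coeff (poly_of v) (m - k)"]
      by (simp add: e_def)
    then have ev: "e \<le> norm v"
      using norm_coeff_le [of v "m - k"] by linarith
    have le: "c1 * norm u * norm v \<le> B" "c2 * norm u * norm w \<le> B"
      using B c1(2) [OF M(1,3)] c2(2) [OF M(1,4)] by linarith+
    have "c1 * (1 * norm v) \<le> c1 * (norm u * norm v)" "c2 * (1 * norm w) \<le> c2 * (norm u * norm w)"
      using u1 c1(1) c2(1) by (intro mult_left_mono mult_right_mono; simp)+
    with le have "c1 * norm v \<le> B" "c2 * norm w \<le> B"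
      unfolding mult.assoc mult_1_left by linarith+
    then have vw: "norm v \<le> B / c1" "norm w \<le> B / c2"
      using c1(1) c2(1) by (simp_all add: field_simps)
    have "c1 * norm u * e \<le> c1 * norm u * norm v"
      using ev c1(1) by (auto intro: mult_left_mono)
    with le(1) have "c1 * norm u * e \<le> B" by linarith
    then have "norm u \<le> B / (c1 * e)"
      using c1(1) e by (simp add: field_simps)
    moreover have "norm z \<le> norm u + (norm v + norm w)"
      unfolding uvw using norm_Pair_le [of u "(v, w)"] norm_Pair_le [of v w] by linarith
    ultimately show ?thesis using vw by linarith
  qed
  then show "bounded ?X"
    by (meson bounded_iff)
qed

text \<open>If the derivative kills \<open>(a, b, c)\<close>, then \<open>u\<close> divides both \<open>a v\<close> and \<open>a w\<close>, hence \<open>a\<close> because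
  \<open>v\<close> and \<open>w\<close> are coprime. As \<open>a\<close> has smaller degree than \<open>u\<close>, it vanishes, and then so do \<open>b\<close> and \<open>c\<close>.\<close>
lemma pair_product_deriv_lower_bound:
  assumes z: "(u, v, w) \<in> monic_triples m n k"
    and cop: "coprime (poly_of v) (poly_of w)" and nz: "v \<noteq> 0"
  obtains c where "c > 0"
    "\<And>d. d \<in> tangent_triples m n k \<Longrightarrow> c * norm d \<le> norm (pair_product_deriv (u, v, w) d)"
proof (rule homogeneous_lower_bound)
  let ?T = "tangent_triples m n k"
  show "subspace ?T" by (rule subspace_tangent_triples)
  show "compact (?T \<inter> sphere 0 1)"
  proof (rule compact_triples)
    show "?T \<inter> sphere 0 1 \<subseteq> polys_le k \<times> polys_le (m - k) \<times> polys_le (n - k)"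
      by (auto simp: tangent_triples_def)
  qed (rule closed_Int [OF closed_tangent_triples closed_unit_sphere], rule bounded_subset [OF bounded_unit_sphere Int_lower2])
  show "continuous_on ?T (pair_product_deriv (u, v, w))"
    unfolding pair_product_deriv_eq [abs_def]
  proof (rule continuous_on_Pair; rule continuous_on_add; rule continuous_on_mult_polys_le [where N = k])
  qed (use z in \<open>auto simp: tangent_triples_def monic_triples_def continuous_on_fst continuous_on_snd continuous_on_const\<close>)
  show "pair_product_deriv (u, v, w) (r *\<^sub>R x) = r *\<^sub>R pair_product_deriv (u, v, w) x" for r x
    by (rule pair_product_deriv_scaleR)
  show "d = 0" if d: "d \<in> ?T" and 0: "pair_product_deriv (u, v, w) d = 0" for d
  proof -
    obtain a b c where abc: "d = (a, b, c)" by (cases d)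
    let ?P = "poly_of"
    have eq: "?P u * ?P b + ?P a * ?P v = 0" "?P u * ?P c + ?P a * ?P w = 0"
      using 0 by (simp_all add: abc zero_prod_def flip: poly_of_ring_simps)
    then have "?P u dvd ?P a * ?P v" "?P u dvd ?P a * ?P w"
      by (simp_all add: add_eq_0_iff)
    then have "?P u dvd gcd (?P a * ?P v) (?P a * ?P w)" by simp
    also have "\<dots> dvd ?P a"
      using cop by (simp add: gcd_mult_left coprime_iff_gcd_eq_1)
    finally have "?P u dvd ?P a" .
    moreover have u: "degree (?P u) = k" "?P u \<noteq> 0"
      using monic_triplesD [OF z] by simp_all
    moreover have "degree (?P a) \<le> k" "coeff (?P a) k = 0"
      using d by (auto simp: abc tangent_triples_def)
    ultimately have a: "?P a = 0"
      by (metis dvd_imp_degree_le antisym leading_coeff_0_iff)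
    with eq u have "?P b = 0" "?P c = 0" by auto
    with a show ?thesis
      by (simp add: abc zero_prod_def)
  qed
qed (use that in blast)

lemma norm_pair_product_deriv_le:
  assumes "fst z \<in> polys_le k" "fst d \<in> polys_le k"
  shows "norm (pair_product_deriv z d) \<le> 4 * real (Suc k) * norm z * norm d"
proof -
  obtain u v w where z: "z = (u, v, w)" by (cases z)
  obtain a b c where d: "d = (a, b, c)" by (cases d)
  have nz: "norm u \<le> norm z" "norm v \<le> norm z" "norm w \<le> norm z"
    using norm_fst_le [of u "(v, w)"] norm_snd_le [of "(v, w)" u] norm_fst_le [of v w] norm_snd_le [of w v]
    by (auto simp: z)
  have nd: "norm a \<le> norm d" "norm b \<le> norm d" "norm c \<le> norm d"
    using norm_fst_le [of a "(b, c)"] norm_snd_le [of "(b, c)" a] norm_fst_le [of b c] norm_snd_le [of c b]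
    by (auto simp: d)
  have *: "norm (x * y) \<le> real (Suc k) * norm z * norm d"
    if "x \<in> polys_le k" "norm x \<le> norm z \<and> norm y \<le> norm d \<or> norm x \<le> norm d \<and> norm y \<le> norm z" for x y
  proof -
    have "norm (x * y) \<le> real (Suc k) * (norm x * norm y)"
      using norm_mult_bounded_degree [of x k y] that(1) by (simp add: mult.assoc)
    also have "norm x * norm y \<le> norm z * norm d"
      using that(2) mult_mono [of "norm x" "norm z" "norm y" "norm d"]
        mult_mono [of "norm x" "norm d" "norm y" "norm z"] by (auto simp: mult.commute)
    finally show ?thesis by (simp add: mult.assoc)
  qed
  have u: "u \<in> polys_le k" "a \<in> polys_le k" using assms by (simp_all add: z d)
  have "norm (u * b) \<le> real (Suc k) * norm z * norm d" "norm (a * v) \<le> real (Suc k) * norm z * norm d"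
    "norm (u * c) \<le> real (Suc k) * norm z * norm d" "norm (a * w) \<le> real (Suc k) * norm z * norm d"
    by (intro *; use u nz nd in blast)+
  then have "norm (u * b + a * v) + norm (u * c + a * w) \<le> 4 * (real (Suc k) * norm z * norm d)"
    using norm_triangle_ineq [of "u * b" "a * v"] norm_triangle_ineq [of "u * c" "a * w"] by linarith
  then show ?thesis
    using norm_Pair_le [of "u * b + a * v" "u * c + a * w"]
    unfolding z d pair_product_deriv.simps mult.assoc by linarith
qed

lemma norm_pair_product_le:
  assumes "fst d \<in> polys_le k"
  shows "norm (pair_product d) \<le> 4 * real (Suc k) * (norm d)\<^sup>2"
proof -
  have "2 * norm (pair_product d) \<le> 4 * real (Suc k) * norm d * norm d"
    using norm_pair_product_deriv_le [OF assms assms] by (simp add: pair_product_deriv_self)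
  moreover have "0 \<le> 4 * real (Suc k) * norm d * norm d" by simp
  ultimately have "norm (pair_product d) \<le> 4 * real (Suc k) * norm d * norm d"
    using norm_ge_zero [of "pair_product d"] by linarith
  then show ?thesis by (simp add: power2_eq_square mult.assoc)
qed

lemma fst_tangent_triples: "d \<in> tangent_triples m n k \<Longrightarrow> fst d \<in> polys_le k"
  by (auto simp: tangent_triples_def)

lemma pair_product_polys_le:
  assumes "k \<le> m" "k \<le> n" "z \<in> monic_triples m n k"
  shows "pair_product z \<in> polys_le m \<times> polys_le n"
proof -
  obtain u v w where z: "z = (u, v, w)" by (cases z)
  have "degree (poly_of u) \<le> k" "degree (poly_of v) \<le> m - k" "degree (poly_of w) \<le> n - k"
    using assms by (auto simp: z monic_triples_def)
  then show ?thesis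
    using assms(1,2) degree_mult_le [of "poly_of u" "poly_of v"] degree_mult_le [of "poly_of u" "poly_of w"]
    by (auto simp: z)
qed

section \<open>Strata of pairs with GCD of given degree\<close>
lemma gcds_iff:
  assumes "p \<noteq> 0"
  shows "u \<in> gcds (p, q) \<longleftrightarrow> poly_sim u (gcd p q)"
proof
  assume "u \<in> gcds (p, q)"
  then have u: "u dvd gcd p q" "degree (gcd p q) \<le> degree u"
    by (auto simp: gcds_def)
  then obtain c where c: "gcd p q = u * c" by (elim dvdE)
  have "u \<noteq> 0" "c \<noteq> 0" using c assms by auto
  then have "degree c = 0"
    using u(2) c by (simp add: degree_mult_eq)
  then obtain a where "c = [:a:]" by (elim degree_eq_zeroE)
  with c \<open>c \<noteq> 0\<close> have "u = smult (inverse a) (gcd p q)" "inverse a \<noteq> 0" by auto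
  then show "poly_sim u (gcd p q)" unfolding poly_sim_def by blast
next
  assume "poly_sim u (gcd p q)"
  then obtain a where a: "a \<noteq> 0" "u = smult a (gcd p q)" by (auto simp: poly_sim_def)
  have "degree d \<le> degree u" if "d dvd p" "d dvd q" for d
    using that assms a by (simp add: dvd_imp_degree_le)
  then show "u \<in> gcds (p, q)"
    using a by (simp add: gcds_def smult_dvd)
qed

lemma degree_poly_sim: "poly_sim u g \<Longrightarrow> degree u = degree g"
  by (auto simp: poly_sim_def)

lemma poly_sim_refl: "poly_sim f f"
  by (auto simp: poly_sim_def intro!: exI [of _ 1])

lemma poly_sim_sym: "poly_sim f g \<Longrightarrow> poly_sim g f"
proof -
  assume "poly_sim f g"
  then obtain a where "a \<noteq> 0" "f = smult a g" by (auto simp: poly_sim_def)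
  then have "inverse a \<noteq> 0" "g = smult (inverse a) f" by auto
  then show "poly_sim g f" unfolding poly_sim_def by blast
qed

lemma poly_sim_trans: "poly_sim f g \<Longrightarrow> poly_sim g h \<Longrightarrow> poly_sim f h"
  unfolding poly_sim_def by (metis mult_eq_0_iff smult_smult)

lemma gcd_stratum_iff:
  "(p, q) \<in> gcd_stratum m n k \<longleftrightarrow> (p, q) \<in> pairs_eq m n \<and> degree (gcd p q) = k"
proof (cases "(p, q) \<in> pairs_eq m n")
  case True
  then have "p \<noteq> 0" by (auto simp: pairs_eq_def)
  with True show ?thesis
    using degree_poly_sim poly_sim_refl by (auto simp: gcd_stratum_def gcds_iff)
qed (auto simp: gcd_stratum_def)

lemma gcd_stratum_le_min:
  assumes "x \<in> gcd_stratum m n k"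
  shows "k \<le> m" "k \<le> n"
proof -
  obtain p q where x: "x = (p, q)" by (cases x)
  have "p \<noteq> 0" "q \<noteq> 0" "degree p = m" "degree q = n" "degree (gcd p q) = k"
    using assms by (auto simp: x gcd_stratum_iff pairs_eq_def)
  then show "k \<le> m" "k \<le> n"
    using dvd_imp_degree_le [OF gcd_dvd1 [of p q]] dvd_imp_degree_le [OF gcd_dvd2 [of p q]] by auto
qed

lemma degree_normalize_poly: "degree (normalize (p :: complex poly)) = degree p"
  by (cases "p = 0") (auto intro!: antisym dvd_imp_degree_le)

text \<open>The pair \<open>x^k x^(m - k)\<close>, \<open>x^k (x + 1)^(n - k)\<close> is a witness. Nonemptiness matters because
  \<open>stratum_dist\<close> is an infimum of reals, which carries no information over the empty set.\<close>
lemma gcd_stratum_nonempty: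
  assumes "k \<le> m" "k \<le> n"
  shows "gcd_stratum m n k \<noteq> {}"
proof -
  let ?x = "[:0, 1:] :: complex poly" and ?y = "[:1, 1:] :: complex poly"
  have "coprime ?x ?y"
  proof (rule coprimeI)
    fix d assume "d dvd ?x" "d dvd ?y"
    then have "d dvd ?y - ?x" by (rule dvd_diff [rotated])
    then show "is_unit d" by (simp add: one_pCons)
  qed
  then have cop: "coprime (?x ^ (m - k)) (?y ^ (n - k))" by simp
  have "gcd (?x ^ k * ?x ^ (m - k)) (?x ^ k * ?y ^ (n - k)) = normalize (?x ^ k)"
    using cop by (simp add: gcd_mult_left coprime_iff_gcd_eq_1 [THEN iffD1] del: power_add)
  then have "degree (gcd (?x ^ k * ?x ^ (m - k)) (?x ^ k * ?y ^ (n - k))) = k"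
    by (simp add: degree_normalize_poly degree_power_eq)
  moreover have "(?x ^ k * ?x ^ (m - k), ?x ^ k * ?y ^ (n - k)) \<in> pairs_eq m n"
    using assms by (simp add: pairs_eq_def degree_mult_eq degree_power_eq)
  ultimately have "(?x ^ k * ?x ^ (m - k), ?x ^ k * ?y ^ (n - k)) \<in> gcd_stratum m n k"
    by (simp only: gcd_stratum_iff simp_thms)
  then show ?thesis by blast
qed

definition pairs_vec :: "complex poly \<times> complex poly \<Rightarrow> cpoly \<times> cpoly" where
  "pairs_vec x = (vec_of (fst x), vec_of (snd x))"

definition polys_pair :: "cpoly \<times> cpoly \<Rightarrow> complex poly \<times> complex poly" where
  "polys_pair y = (poly_of (fst y), poly_of (snd y))"

lemma polys_pair_pairs_vec [simp]: "polys_pair (pairs_vec x) = x"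
  and pairs_vec_polys_pair [simp]: "pairs_vec (polys_pair y) = y"
  by (simp_all add: pairs_vec_def polys_pair_def poly_of_inverse)

lemma pair_norm_diff: "pair_norm (x - y) = dist (pairs_vec x) (pairs_vec y)"
  by (cases x; cases y)
     (simp add: pair_norm_def pairs_vec_def dist_norm norm_prod_def norm_vec_of flip: vec_of_diff)

definition stratum :: "nat \<Rightarrow> nat \<Rightarrow> nat \<Rightarrow> (cpoly \<times> cpoly) set" where
  "stratum m n k = {y. polys_pair y \<in> gcd_stratum m n k}"

lemma stratum_iff:
  "(a, b) \<in> stratum m n k \<longleftrightarrow> a \<noteq> 0 \<and> b \<noteq> 0 \<and> degree (poly_of a) = m \<and> degree (poly_of b) = n
     \<and> degree (gcd (poly_of a) (poly_of b)) = k"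
  by (auto simp: stratum_def polys_pair_def gcd_stratum_iff pairs_eq_def)

lemma stratum_le: "y \<in> stratum m n k \<Longrightarrow> k \<le> m" "y \<in> stratum m n k \<Longrightarrow> k \<le> n"
  by (auto simp: stratum_def dest: gcd_stratum_le_min)

lemma stratum_subset_image:
  assumes "y \<in> stratum m n k"
  obtains z where "z \<in> monic_triples m n k" "pair_product z = y"
proof -
  define p q where "p = poly_of (fst y)" and "q = poly_of (snd y)"
  then have y: "y = (vec_of p, vec_of q)"
    by (simp add: poly_of_inverse)
  define g where "g = gcd p q"
  define a where "a = lead_coeff g"
  have g: "p \<noteq> 0" "q \<noteq> 0" "degree p = m" "degree q = n" "degree g = k" "g \<noteq> 0"
    using assms by (auto simp: y stratum_iff g_def vec_of_0)
  from g(6) have a: "a \<noteq> 0" by (simp add: a_def)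
  have "g dvd p" "g dvd q" by (simp_all add: g_def)
  then obtain p' q' where p': "p = g * p'" and q': "q = g * q'"
    by (auto elim!: dvdE)
  have "p' \<noteq> 0" "q' \<noteq> 0" using g(1,2) p' q' by auto
  then have "m = k + degree p'" "n = k + degree q'"
    using g(3-6) degree_mult_eq [of g p'] degree_mult_eq [of g q'] by (simp_all add: p' q')
  then have deg: "degree p' \<le> m - k" "degree q' \<le> n - k" by simp_all
  have lead: "coeff g k = a" by (simp add: a_def g(5))
  show ?thesis
  proof (rule that)
    show "(vec_of (smult (inverse a) g), vec_of (smult a p'), vec_of (smult a q')) \<in> monic_triples m n k"
      using a g(5) deg lead by (simp add: monic_triples_def)
    show "pair_product (vec_of (smult (inverse a) g), vec_of (smult a p'), vec_of (smult a q')) = y"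
      using a by (simp add: y p' q' vec_of_mult [symmetric])
  qed
qed

lemma degree_gcd_pair_product:
  assumes "(u, v, w) \<in> monic_triples m n k" "v \<noteq> 0"
  shows "degree (gcd (poly_of (u * v)) (poly_of (u * w))) = k + degree (gcd (poly_of v) (poly_of w))"
  using monic_triplesD [OF assms(1)] assms(2)
  by (simp add: gcd_mult_left degree_normalize_poly degree_mult_eq)

text \<open>A triple certifies a common divisor of degree \<open>k\<close>, though not yet a greatest one.\<close>
lemma pair_product_in_stratum:
  assumes z: "z \<in> monic_triples m n k" and y: "pair_product z \<in> stratum m n j"
  shows "k \<le> j"
proof -
  obtain u v w where z': "z = (u, v, w)" by (cases z)
  have "v \<noteq> 0" using y by (auto simp: z' stratum_iff)
  then show ?thesis
    using degree_gcd_pair_product [of u v w m n k] z y by (simp add: z' stratum_iff)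
qed

lemma coprime_cofactors:
  assumes z: "(u, v, w) \<in> monic_triples m n k" and y: "pair_product (u, v, w) \<in> stratum m n k"
  shows "v \<noteq> 0" "coprime (poly_of v) (poly_of w)"
proof -
  show v: "v \<noteq> 0" using y by (auto simp: stratum_iff)
  have "degree (gcd (poly_of v) (poly_of w)) = 0"
    using degree_gcd_pair_product [OF z v] y by (simp add: stratum_iff)
  moreover have "gcd (poly_of v) (poly_of w) \<noteq> 0" using v by simp
  ultimately show "coprime (poly_of v) (poly_of w)"
    unfolding is_unit_gcd [symmetric] using is_unit_iff_degree by blast
qed

lemma in_gcds_pair_product:
  assumes z: "(u, v, w) \<in> monic_triples m n k" and y: "pair_product (u, v, w) \<in> stratum m n k"
  shows "poly_of u \<in> gcds (polys_pair (pair_product (u, v, w)))"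
proof -
  have deg: "degree (gcd (poly_of (u * v)) (poly_of (u * w))) = k" and nz: "u * v \<noteq> 0"
    using y by (auto simp: stratum_iff)
  have "degree d \<le> degree (poly_of u)" if "d dvd poly_of (u * v)" "d dvd poly_of (u * w)" for d
  proof -
    have "degree d \<le> degree (gcd (poly_of (u * v)) (poly_of (u * w)))"
      using that nz by (intro dvd_imp_degree_le gcd_greatest) (auto simp del: poly_of_ring_simps)
    then show ?thesis using deg monic_triplesD [OF z] by simp
  qed
  then show ?thesis
    by (simp add: gcds_def polys_pair_def)
qed

text \<open>Over a pair whose GCD has degree exactly \<open>k\<close>, the factor \<open>u\<close> is the monic GCD.\<close>
lemma pair_product_inj:
  assumes z: "z \<in> monic_triples m n k" and z': "z' \<in> monic_triples m n k"
    and eq: "pair_product z = pair_product z'" and y: "pair_product z \<in> stratum m n k"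
  shows "z = z'"
proof -
  obtain u v w where uvw: "z = (u, v, w)" by (cases z)
  obtain u' v' w' where uvw': "z' = (u', v', w')" by (cases z')
  have "u * v \<noteq> 0" using y by (auto simp: uvw stratum_iff)
  then have nz: "poly_of (u * v) \<noteq> 0" by (simp only: poly_of_eq_0_iff not_False_eq_True)
  let ?g = "gcd (poly_of (u * v)) (poly_of (u * w))"
  have "poly_of u \<in> gcds (poly_of (u * v), poly_of (u * w))"
    using in_gcds_pair_product [of u v w m n k] z y by (simp add: uvw polys_pair_def)
  then have "poly_sim (poly_of u) ?g"
    by (rule gcds_iff [OF nz, THEN iffD1])
  moreover have "poly_of u' \<in> gcds (poly_of (u * v), poly_of (u * w))"
    using in_gcds_pair_product [of u' v' w' m n k] z' y eq by (simp add: uvw uvw' polys_pair_def)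
  then have "poly_sim (poly_of u') ?g"
    by (rule gcds_iff [OF nz, THEN iffD1])
  ultimately have "poly_sim (poly_of u) (poly_of u')"
    by (rule poly_sim_trans [OF _ poly_sim_sym])
  then obtain a where a: "poly_of u = smult a (poly_of u')" by (auto simp: poly_sim_def)
  have "coeff (poly_of u) k = 1" "coeff (poly_of u') k = 1"
    using z z' by (auto simp: uvw uvw' monic_triples_def)
  with a have "a = 1" by simp
  with a have u: "u = u'" by (simp add: poly_of_inject)
  have "poly_of u \<noteq> 0" using monic_triplesD [of u v w] z by (simp add: uvw)
  moreover have "poly_of u * poly_of v = poly_of u * poly_of v'" "poly_of u * poly_of w = poly_of u * poly_of w'"
    using eq by (simp_all add: uvw uvw' u flip: poly_of_ring_simps)
  ultimately have "poly_of v = poly_of v'" "poly_of w = poly_of w'" by simp_all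
  with u show ?thesis by (simp add: uvw uvw' poly_of_inject)
qed

section \<open>Two nearest points in an inner product space\<close>

text \<open>First order condition: along the curve \<open>t b + t^2 c\<close> the squared distance to \<open>a\<close> has one-sided
  derivative \<open>- 2 (a \<bullet> b)\<close> at 0.\<close>
lemma nearest_on_curve_imp_inner_le_0:
  fixes a b c :: "'a::real_inner"
  assumes "\<And>t::real. 0 < t \<Longrightarrow> t \<le> 1 \<Longrightarrow> norm a \<le> norm (a - (t *\<^sub>R b + t\<^sup>2 *\<^sub>R c))"
  shows "a \<bullet> b \<le> 0"
proof (rule ccontr)
  assume "\<not> a \<bullet> b \<le> 0"
  then have pos: "a \<bullet> b > 0" by simp
  define K where "K = (norm b + norm c)\<^sup>2 + 2 * norm a * norm c"
  have K: "K \<ge> 0" by (simp add: K_def)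
  \<comment> \<open>\<open>K\<close> bounds the second order terms, so this step makes them smaller than the first order gain.\<close>
  define t where "t = min 1 (a \<bullet> b / (K + 1))"
  have t: "0 < t" "t \<le> 1" using pos K by (auto simp: t_def)
  let ?x = "b + t *\<^sub>R c"
  have "norm a \<le> norm (a - t *\<^sub>R ?x)"
    using assms [OF t] by (simp add: algebra_simps power2_eq_square)
  then have "(norm a)\<^sup>2 \<le> (norm (a - t *\<^sub>R ?x))\<^sup>2"
    by (simp add: power_mono)
  also have "\<dots> = (norm a)\<^sup>2 - 2 * (a \<bullet> (t *\<^sub>R ?x)) + (norm (t *\<^sub>R ?x))\<^sup>2"
    by (simp only: power2_norm_eq_inner inner_diff_left inner_diff_right inner_commute [of "t *\<^sub>R ?x" a])
  finally have "2 * (a \<bullet> (t *\<^sub>R ?x)) \<le> (norm (t *\<^sub>R ?x))\<^sup>2" by linarith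
  then have "t * (2 * (a \<bullet> ?x)) \<le> t * (t * (norm ?x)\<^sup>2)"
    unfolding inner_scaleR_right norm_scaleR power_mult_distrib by (simp add: power2_eq_square mult.assoc mult.left_commute)
  then have "2 * (a \<bullet> ?x) \<le> t * (norm ?x)\<^sup>2"
    using t by (simp only: mult_le_cancel_left_pos)
  moreover have "norm ?x \<le> norm b + norm c"
    using norm_triangle_ineq [of b "t *\<^sub>R c"] mult_right_mono [OF t(2) norm_ge_zero [of c]] t by simp
  then have "t * (norm ?x)\<^sup>2 \<le> t * (norm b + norm c)\<^sup>2"
    using t by (intro mult_left_mono power_mono) auto
  moreover have "- (a \<bullet> c) \<le> norm a * norm c"
    using Cauchy_Schwarz_ineq2 [of a c] by linarith
  then have "t * (- (a \<bullet> c)) \<le> t * (norm a * norm c)"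
    using t by (intro mult_left_mono) auto
  ultimately have "2 * (a \<bullet> b) \<le> t * K"
    by (simp add: K_def inner_add_right algebra_simps)
  also have "t * K \<le> a \<bullet> b / (K + 1) * K"
    using K by (intro mult_right_mono) (auto simp: t_def)
  also have "\<dots> \<le> a \<bullet> b"
    using pos K by (simp add: field_simps)
  finally show False using pos by simp
qed

text \<open>Here \<open>b\<close> is the derivative at the first parameter in direction of the second one, and \<open>c\<close> is the
  quadratic remainder, so that \<open>b + 2 c\<close> is the derivative at the second parameter in the same
  direction. Subtracting the two first order conditions leaves
  \<open>\<bar>b\<bar>^2\<close> up to terms that are controlled by \<open>x1 - x2\<close> or absorbed thanks to \<open>small\<close>.\<close>
lemma nearest_points_stable:
  fixes x1 x2 y1 y2 b c :: "'a::real_inner"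
  assumes y2: "y2 = y1 + b + c"
    and opt1: "(x1 - y1) \<bullet> b \<le> 0" and opt2: "0 \<le> (x2 - y2) \<bullet> (b + 2 *\<^sub>R c)"
    and small: "norm c \<le> norm b / 4" "norm (x2 - y2) * norm c \<le> (norm b)\<^sup>2 / 8"
  shows "norm b \<le> 2 * norm (x1 - x2)"
proof -
  have "(norm b)\<^sup>2 = (x1 - y1) \<bullet> b - (x2 - y2) \<bullet> (b + 2 *\<^sub>R c) - (x1 - x2) \<bullet> b - c \<bullet> b
      + 2 * ((x2 - y2) \<bullet> c)"
    by (simp add: y2 power2_norm_eq_inner inner_add_left inner_add_right inner_diff_left)
  also have "\<dots> \<le> norm (x1 - x2) * norm b + norm c * norm b + 2 * (norm (x2 - y2) * norm c)"
    using opt1 opt2 Cauchy_Schwarz_ineq2 [of "x1 - x2" b] Cauchy_Schwarz_ineq2 [of c b]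
      Cauchy_Schwarz_ineq2 [of "x2 - y2" c] by linarith
  also have "\<dots> \<le> norm (x1 - x2) * norm b + norm b / 4 * norm b + 2 * ((norm b)\<^sup>2 / 8)"
    using small by (intro add_mono mult_right_mono mult_left_mono) auto
  finally have "norm b * norm b \<le> norm b * (2 * norm (x1 - x2))"
    by (simp add: power2_eq_square algebra_simps)
  then show ?thesis
    by (cases "norm b = 0") (simp_all add: mult_le_cancel_left)
qed

section \<open>The strata near a given pair\<close>
lemma pairs_eq_near:
  assumes y: "polys_pair y \<in> pairs_eq m n"
  obtains r where "r > 0"
    "\<And>y'. y' \<in> polys_le m \<times> polys_le n \<Longrightarrow> dist y y' < r \<Longrightarrow> polys_pair y' \<in> pairs_eq m n"
    "r < norm (coeff (poly_of (fst y)) m)"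
proof -
  let ?a = "\<lambda>y::cpoly \<times> cpoly. coeff (poly_of (fst y)) m" and ?b = "\<lambda>y::cpoly \<times> cpoly. coeff (poly_of (snd y)) n"
  define r where "r = min (norm (?a y)) (norm (?b y)) / 2"
  have "?a y \<noteq> 0" "?b y \<noteq> 0"
    using y by (auto simp: polys_pair_def pairs_eq_def)
  then have "norm (?a y) > 0" "norm (?b y) > 0" by simp_all
  then have r: "r > 0" "r < norm (?a y)" "r < norm (?b y)"
    unfolding r_def by linarith+
  have "polys_pair y' \<in> pairs_eq m n" if y': "y' \<in> polys_le m \<times> polys_le n" "dist y y' < r" for y'
  proof -
    have "norm (?a y - ?a y') \<le> norm (fst y - fst y')" "norm (?b y - ?b y') \<le> norm (snd y - snd y')"
      using norm_coeff_le [of "fst y - fst y'" m] norm_coeff_le [of "snd y - snd y'" n] by simp_all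
    moreover have "norm (fst y - fst y') \<le> dist y y'" "norm (snd y - snd y') \<le> dist y y'"
      using dist_fst_le [of y y'] dist_snd_le [of y y'] by (simp_all add: dist_norm)
    ultimately have "?a y' \<noteq> 0" "?b y' \<noteq> 0"
      using r y'(2) by auto
    then have "m \<le> degree (poly_of (fst y'))" "n \<le> degree (poly_of (snd y'))" "fst y' \<noteq> 0" "snd y' \<noteq> 0"
      by (auto intro: le_degree)
    then have "degree (poly_of (fst y')) = m" "degree (poly_of (snd y')) = n" "fst y' \<noteq> 0" "snd y' \<noteq> 0"
      using y'(1) by (simp_all add: mem_Times_iff)
    then show ?thesis by (simp add: polys_pair_def pairs_eq_def)
  qed
  with r show ?thesis using that by blast
qed

lemma closed_imp_distance_pos:
  fixes a :: "'a::metric_space"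
  assumes "closed S" "a \<notin> S"
  obtains d where "d > 0" "\<And>x. x \<in> S \<Longrightarrow> d \<le> dist a x"
proof -
  have "open (- S)" "a \<in> - S" using assms by auto
  then obtain d where "d > 0" "ball a d \<subseteq> - S"
    by (meson open_contains_ball)
  then have "\<forall>x\<in>S. d \<le> dist a x" by force
  with \<open>d > 0\<close> show ?thesis using that by blast
qed

text \<open>Upper semicontinuity of the degree of the GCD. By properness, the part of a stratum of degree
  \<open>j > k\<close> near \<open>y\<close> lies in a compact set of pairs that all have a common divisor of degree \<open>j\<close>, and
  \<open>y\<close> is not among them.\<close>
lemma higher_strata_away:
  assumes y: "y \<in> stratum m n k"
  obtains r where "r > 0" "\<And>j y'. k < j \<Longrightarrow> y' \<in> stratum m n j \<Longrightarrow> r \<le> dist y y'"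
proof -
  have "polys_pair y \<in> pairs_eq m n"
    using y by (auto simp: stratum_def gcd_stratum_def)
  then obtain \<rho> where \<rho>: "\<rho> > 0" "\<rho> < norm (coeff (poly_of (fst y)) m)"
    by (rule pairs_eq_near)
  let ?X = "\<lambda>j. {z \<in> monic_triples m n j. pair_product z \<in> cball y \<rho>}"
  let ?K = "\<Union>j\<in>{k<..m}. pair_product ` ?X j"
  have "compact (pair_product ` ?X j)" if "j \<le> m" for j
    using compact_pair_product_preimage [OF that \<rho>(2)]
    by (rule compact_continuous_image [rotated])
       (rule continuous_on_subset [OF continuous_on_pair_product], auto)
  then have "closed ?K"
    by (intro compact_imp_closed compact_UN) auto
  moreover have "y \<notin> ?K"
  proof
    assume "y \<in> ?K"
    then obtain j z where j: "k < j" "z \<in> monic_triples m n j" "pair_product z = y" by auto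
    then have "j \<le> k" using pair_product_in_stratum [OF j(2), of k] y by simp
    with j(1) show False by simp
  qed
  ultimately obtain d where d: "d > 0" "\<And>y'. y' \<in> ?K \<Longrightarrow> d \<le> dist y y'"
    by (rule closed_imp_distance_pos) blast
  show ?thesis
  proof (rule that [of "min d \<rho>"])
    show "min d \<rho> > 0" using d \<rho> by simp
  next
    fix j y' assume j: "k < j" "y' \<in> stratum m n j"
    then obtain z where z: "z \<in> monic_triples m n j" "pair_product z = y'"
      using stratum_subset_image [OF j(2)] by blast
    have "j \<le> m" using j stratum_le by blast
    show "min d \<rho> \<le> dist y y'"
    proof (cases "dist y y' \<le> \<rho>")
      case True
      then have "y' \<in> ?K" using z j \<open>j \<le> m\<close> by auto
      then have "d \<le> dist y y'" by (rule d(2))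
      then show ?thesis by simp
    qed simp
  qed
qed

text \<open>Continuity of the inverse of the product map at \<open>z\<close>: triples at distance at least \<open>\<delta>\<close> from \<open>z\<close>
  with product near that of \<open>z\<close> form a compact set, and by injectivity its image misses that product.\<close>
lemma triples_near:
  assumes z: "z \<in> monic_triples m n k" and y: "pair_product z \<in> stratum m n k" and \<delta>: "\<delta> > 0"
  obtains r where "r > 0"
    "\<And>z'. z' \<in> monic_triples m n k \<Longrightarrow> dist (pair_product z) (pair_product z') < r \<Longrightarrow> dist z z' < \<delta>"
proof -
  let ?y = "pair_product z"
  have "polys_pair ?y \<in> pairs_eq m n"
    using y by (auto simp: stratum_def gcd_stratum_def)
  then obtain \<rho> where \<rho>: "\<rho> > 0" "\<rho> < norm (coeff (poly_of (fst ?y)) m)"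
    by (rule pairs_eq_near)
  let ?X = "{z' \<in> monic_triples m n k. pair_product z' \<in> cball ?y \<rho>} \<inter> - ball z \<delta>"
  have "k \<le> m" using y stratum_le by blast
  then have "compact ?X"
    using compact_pair_product_preimage \<rho>(2) by (intro compact_Int_closed) auto
  moreover have "continuous_on ?X pair_product"
    by (rule continuous_on_subset [OF continuous_on_pair_product]) auto
  ultimately have "closed (pair_product ` ?X)"
    by (intro compact_imp_closed compact_continuous_image)
  moreover have "?y \<notin> pair_product ` ?X"
  proof
    assume "?y \<in> pair_product ` ?X"
    then obtain z' where z': "z' \<in> monic_triples m n k" "pair_product z = pair_product z'" "z' \<notin> ball z \<delta>" by blast
    have "z = z'" by (rule pair_product_inj [OF z z'(1,2) y])
    with z'(3) \<delta> show False by simp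
  qed
  ultimately obtain d where d: "d > 0" "\<And>y'. y' \<in> pair_product ` ?X \<Longrightarrow> d \<le> dist ?y y'"
    by (rule closed_imp_distance_pos) blast
  show ?thesis
  proof (rule that [of "min d \<rho>"])
    show "min d \<rho> > 0" using d \<rho> by simp
  next
    fix z' assume z': "z' \<in> monic_triples m n k" "dist ?y (pair_product z') < min d \<rho>"
    show "dist z z' < \<delta>"
    proof (rule ccontr)
      assume "\<not> dist z z' < \<delta>"
      then have "pair_product z' \<in> pair_product ` ?X" using z' by auto
      then have "d \<le> dist ?y (pair_product z')" by (rule d(2))
      with z'(2) show False by simp
    qed
  qed
qed

text \<open>One radius for all local properties. Close to \<open>y\<close>, products of triples have exact
  degrees \<open>m\<close> and \<open>n\<close>, a common divisor of degree \<open>k\<close>, and no larger one.\<close>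
lemma stratum_near:
  assumes y: "y \<in> stratum m n k"
  obtains r where "r > 0" "r < norm (coeff (poly_of (fst y)) m)"
    "\<And>y'. y' \<in> polys_le m \<times> polys_le n \<Longrightarrow> dist y y' < r \<Longrightarrow> polys_pair y' \<in> pairs_eq m n"
    "\<And>j y'. k < j \<Longrightarrow> y' \<in> stratum m n j \<Longrightarrow> r \<le> dist y y'"
    "\<And>z. z \<in> monic_triples m n k \<Longrightarrow> dist y (pair_product z) < r \<Longrightarrow> pair_product z \<in> stratum m n k"
proof -
  have "polys_pair y \<in> pairs_eq m n"
    using y by (auto simp: stratum_def gcd_stratum_def)
  then obtain r1 where r1: "r1 > 0"
      "\<And>y'. y' \<in> polys_le m \<times> polys_le n \<Longrightarrow> dist y y' < r1 \<Longrightarrow> polys_pair y' \<in> pairs_eq m n"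
      "r1 < norm (coeff (poly_of (fst y)) m)"
    by (rule pairs_eq_near) blast
  obtain r2 where r2: "r2 > 0" "\<And>j y'. k < j \<Longrightarrow> y' \<in> stratum m n j \<Longrightarrow> r2 \<le> dist y y'"
    using higher_strata_away [OF y] by blast
  define r where "r = min r1 r2"
  show ?thesis
  proof (rule that [of r])
    show "r > 0" "r < norm (coeff (poly_of (fst y)) m)"
      using r1 r2 by (auto simp: r_def)
    show pe: "polys_pair y' \<in> pairs_eq m n" if "y' \<in> polys_le m \<times> polys_le n" "dist y y' < r" for y'
      using that r1(2) by (auto simp: r_def)
    show le: "r \<le> dist y y'" if "k < j" "y' \<in> stratum m n j" for j y'
      using r2(2) [OF that] by (simp add: r_def)
    show "pair_product z \<in> stratum m n k" if z: "z \<in> monic_triples m n k" "dist y (pair_product z) < r" for z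
    proof -
      obtain p q where pq: "polys_pair (pair_product z) = (p, q)" by (cases "polys_pair (pair_product z)")
      have "(p, q) \<in> pairs_eq m n"
        using pe [OF pair_product_polys_le [OF stratum_le [OF y] z(1)] z(2)] pq by simp
      then have *: "pair_product z \<in> stratum m n (degree (gcd p q))"
        by (simp add: stratum_def pq gcd_stratum_iff)
      then have "k \<le> degree (gcd p q)"
        by (rule pair_product_in_stratum [OF z(1)])
      moreover have "\<not> k < degree (gcd p q)"
        using le [OF _ *] z(2) by force
      ultimately show ?thesis using * by simp
    qed
  qed
qed

definition nearest :: "'a::metric_space set \<Rightarrow> 'a \<Rightarrow> 'a \<Rightarrow> bool" where
  "nearest S x y \<longleftrightarrow> y \<in> S \<and> (\<forall>y'\<in>S. dist x y \<le> dist x y')"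

text \<open>The stratum is not closed, but its part near \<open>y\<close> is the image of a compact set of triples. The
  stratum contains \<open>y\<close>, so a point of it farther than \<open>2 s\<close> from \<open>y\<close> cannot be nearest
  to a point within \<open>s\<close> of \<open>y\<close>; this explains the halved radius.\<close>
lemma nearest_in_stratum_exists:
  assumes y: "y \<in> stratum m n k"
  obtains r where "r > 0" "\<And>x. dist y x < r \<Longrightarrow> \<exists>y'. nearest (stratum m n k) x y'"
proof -
  obtain r where r: "r > 0" "r < norm (coeff (poly_of (fst y)) m)"
    "\<And>z. z \<in> monic_triples m n k \<Longrightarrow> dist y (pair_product z) < r \<Longrightarrow> pair_product z \<in> stratum m n k"
    by (rule stratum_near [OF y]) blast
  let ?X = "{z \<in> monic_triples m n k. pair_product z \<in> cball y r}"
  have "compact ?X"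
    using stratum_le [OF y] r(2) by (intro compact_pair_product_preimage)
  moreover have "continuous_on ?X pair_product"
    by (rule continuous_on_subset [OF continuous_on_pair_product]) auto
  ultimately have cpt: "compact (pair_product ` ?X)"
    by (intro compact_continuous_image)
  have img: "y' \<in> pair_product ` ?X" if y': "y' \<in> stratum m n k" "dist y y' \<le> r" for y'
  proof -
    obtain z where "z \<in> monic_triples m n k" "pair_product z = y'"
      by (rule stratum_subset_image [OF y'(1)])
    with y'(2) show ?thesis by (intro image_eqI [of _ _ z]) simp_all
  qed
  then have yX: "y \<in> pair_product ` ?X" using y r by simp
  show ?thesis
  proof (rule that [of "r / 2"])
    fix x assume x: "dist y x < r / 2"
    have "continuous_on (pair_product ` ?X) (dist x)"
      by (intro continuous_intros)
    then obtain y' where y': "y' \<in> pair_product ` ?X" "\<And>y''. y'' \<in> pair_product ` ?X \<Longrightarrow> dist x y' \<le> dist x y''"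
      using continuous_attains_inf [OF cpt] yX by blast
    have xy': "dist x y' < r / 2"
      using y'(2) [OF yX] x by (simp add: dist_commute)
    then have "dist y y' < r"
      using x dist_triangle [of y y' x] by linarith
    then have "y' \<in> stratum m n k" using y'(1) r(3) by auto
    moreover have "dist x y' \<le> dist x y''" if "y'' \<in> stratum m n k" for y''
    proof (cases "dist y y'' \<le> r")
      case True
      then show ?thesis using y'(2) [OF img [OF that]] by simp
    next
      case False
      then show ?thesis using xy' x dist_triangle [of y y'' x] by linarith
    qed
    ultimately show "\<exists>y'. nearest (stratum m n k) x y'" unfolding nearest_def by blast
  qed (use r in simp)
qed

section \<open>Lipschitz continuity of the nearest triples\<close>

text \<open>Convexity of the parameter set keeps the segment from \<open>z\<close> to \<open>z'\<close> admissible.\<close>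
lemma nearest_imp_orthogonal_le_0:
  assumes z: "z \<in> M" and z': "z' \<in> M" and M: "convex M" "pair_product ` M \<subseteq> S"
    and near: "nearest S x (pair_product z)"
  shows "(x - pair_product z) \<bullet> pair_product_deriv z (z' - z) \<le> 0"
proof (rule nearest_on_curve_imp_inner_le_0)
  fix t :: real assume t: "0 < t" "t \<le> 1"
  let ?d = "z' - z"
  have "z + t *\<^sub>R ?d = (1 - t) *\<^sub>R z + t *\<^sub>R z'" by (simp add: algebra_simps)
  then have "z + t *\<^sub>R ?d \<in> M"
    using convexD [OF M(1) z z', of "1 - t" t] t by simp
  then have "pair_product (z + t *\<^sub>R ?d) \<in> S" using M(2) by blast
  then have "dist x (pair_product z) \<le> dist x (pair_product (z + t *\<^sub>R ?d))"
    using near by (simp add: nearest_def)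
  then show "norm (x - pair_product z)
      \<le> norm (x - pair_product z - (t *\<^sub>R pair_product_deriv z ?d + t\<^sup>2 *\<^sub>R pair_product ?d))"
    by (simp add: dist_norm pair_product_add pair_product_deriv_scaleR pair_product_scaleR diff_diff_add add.assoc)
qed

text \<open>Near \<open>z\<close> the derivative of the product map retains half of its lower bound \<open>c0\<close> at \<open>z\<close>. The radii
  \<open>\<delta>\<close> for parameters and \<open>r\<close> for pairs are taken so small that the hypotheses of
  \<open>nearest_points_stable\<close> hold for nearest points of any two pairs within \<open>r\<close> of \<open>y\<close>; \<open>C\<close> bounds the product map and its derivative.\<close>
lemma nearest_in_stratum_lipschitz:
  assumes y: "y \<in> stratum m n k"
  obtains r L where "r > 0" "L > 0"
    "\<And>x1 x2 y1 y2. dist y x1 < r \<Longrightarrow> dist y x2 < r \<Longrightarrow>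
       nearest (stratum m n k) x1 y1 \<Longrightarrow> nearest (stratum m n k) x2 y2 \<Longrightarrow>
       \<exists>z1\<in>monic_triples m n k. \<exists>z2\<in>monic_triples m n k.
         pair_product z1 = y1 \<and> pair_product z2 = y2 \<and> dist z1 z2 \<le> L * dist x1 x2"
proof -
  let ?M = "monic_triples m n k" and ?S = "stratum m n k"
  obtain z where z: "z \<in> ?M" "pair_product z = y"
    by (rule stratum_subset_image [OF y])
  obtain c0 where c0: "c0 > 0" "\<And>d. d \<in> tangent_triples m n k \<Longrightarrow> c0 * norm d \<le> norm (pair_product_deriv z d)"
  proof -
    obtain u v w where uvw: "z = (u, v, w)" by (cases z)
    have "v \<noteq> 0" "coprime (poly_of v) (poly_of w)"
      using coprime_cofactors [of u v w m n k] z y by (simp_all add: uvw)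
    then show ?thesis
      using pair_product_deriv_lower_bound [of u v w m n k] z that unfolding uvw by blast
  qed
  define C where "C = 4 * real (Suc k)"
  have C: "C > 0" by (simp add: C_def)
  define c where "c = c0 / 2"
  have c: "c > 0" using c0 by (simp add: c_def)
  obtain r1 where r1: "r1 > 0"
    "\<And>z. z \<in> ?M \<Longrightarrow> dist y (pair_product z) < r1 \<Longrightarrow> pair_product z \<in> ?S"
    by (rule stratum_near [OF y]) blast
  obtain \<delta>1 where \<delta>1: "\<delta>1 > 0" "\<And>z'. z' \<in> ?M \<Longrightarrow> dist z' z < \<delta>1 \<Longrightarrow> dist (pair_product z') (pair_product z) < r1"
    using continuous_on_pair_product [of m n k] z(1) r1(1) unfolding continuous_on_iff by blast
  \<comment> \<open>Two parameters in the ball differ by at most \<open>2 \<delta>\<close>, so the remainder is at most \<open>2 C \<delta> \<le> c / 4\<close> times their distance.\<close>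
  define \<delta> where "\<delta> = min \<delta>1 (c / (8 * C))"
  have \<delta>: "\<delta> > 0" "\<delta> \<le> \<delta>1" "8 * (C * \<delta>) \<le> c"
    using \<delta>1 c C by (auto simp: \<delta>_def min_def field_simps)
  let ?N = "?M \<inter> ball z \<delta>"
  have N: "convex ?N" "pair_product ` ?N \<subseteq> ?S"
  proof -
    show "convex ?N" by (intro convex_Int convex_monic_triples convex_ball)
    show "pair_product ` ?N \<subseteq> ?S"
    proof (rule image_subsetI)
      fix z' assume "z' \<in> ?N"
      then have z': "z' \<in> ?M" "dist z' z < \<delta>1" using \<delta>(2) by (simp_all add: dist_commute)
      then have "dist y (pair_product z') < r1"
        using \<delta>1(2) [OF z'] by (simp add: z(2) dist_commute)
      then show "pair_product z' \<in> ?S" by (rule r1(2) [OF z'(1)])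
    qed
  qed
  have "pair_product z \<in> ?S" using z y by simp
  then obtain r2 where r2: "r2 > 0"
    "\<And>z'. z' \<in> ?M \<Longrightarrow> dist y (pair_product z') < r2 \<Longrightarrow> dist z z' < \<delta>"
    using triples_near [OF z(1) _ \<delta>(1)] unfolding z(2) by blast
  \<comment> \<open>A nearest point of a pair within \<open>r\<close> of \<open>y\<close> is within \<open>2 r\<close> of \<open>y\<close>, since \<open>y\<close> itself competes.\<close>
  define r where "r = min (r2 / 2) (c\<^sup>2 / (8 * C))"
  have r: "r > 0" "2 * r \<le> r2" "8 * (C * r) \<le> c\<^sup>2"
    using r2 c C by (auto simp: r_def min_def field_simps)
  have lift: "\<exists>z1\<in>?N. pair_product z1 = y1" "dist x1 y1 < r"
    if "dist y x1 < r" "nearest ?S x1 y1" for x1 y1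
  proof -
    have "dist x1 y1 \<le> dist x1 y" "y1 \<in> ?S" using that(2) y by (auto simp: nearest_def)
    with that(1) show *: "dist x1 y1 < r" by (simp add: dist_commute)
    with that(1) have r2': "dist y y1 < r2" using dist_triangle [of y y1 x1] r(2) by linarith
    obtain z1 where z1: "z1 \<in> ?M" "pair_product z1 = y1"
      by (rule stratum_subset_image [OF \<open>y1 \<in> ?S\<close>])
    have "dist z z1 < \<delta>"
      by (rule r2(2) [OF z1(1)]) (simp add: z1(2) r2')
    with z1 show "\<exists>z1\<in>?N. pair_product z1 = y1" by (intro bexI [of _ z1]) simp_all
  qed
  show ?thesis
  proof (rule that [of r "2 / c"])
    fix x1 x2 y1 y2
    assume x: "dist y x1 < r" "dist y x2 < r" and near: "nearest ?S x1 y1" "nearest ?S x2 y2"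
    obtain z1 z2 where z1: "z1 \<in> ?N" "pair_product z1 = y1" and z2: "z2 \<in> ?N" "pair_product z2 = y2"
      using lift(1) [OF x(1) near(1)] lift(1) [OF x(2) near(2)] by blast
    define d where "d = z2 - z1"
    define b where "b = pair_product_deriv z1 d"
    have dT: "d \<in> tangent_triples m n k" and eT: "z - z1 \<in> tangent_triples m n k"
      using z1 z2 z by (auto simp: d_def intro: monic_triples_diff)
    have y2: "y2 = y1 + b + pair_product d"
      using pair_product_add [of z1 d] z1 z2 by (simp add: d_def b_def)
    have opt1: "(x1 - y1) \<bullet> b \<le> 0"
      using nearest_imp_orthogonal_le_0 [OF z1(1) z2(1) N, of x1] near(1) z1(2) by (simp add: b_def d_def)
    have "pair_product_deriv z2 d = b + 2 *\<^sub>R pair_product d"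
      using pair_product_deriv_diff [of z2 d z1] pair_product_deriv_self [of d]
      by (simp add: b_def d_def algebra_simps)
    then have "pair_product_deriv z2 (z1 - z2) = - (b + 2 *\<^sub>R pair_product d)"
      using pair_product_deriv_uminus [of z2 d] by (simp add: d_def)
    moreover have "(x2 - y2) \<bullet> pair_product_deriv z2 (z1 - z2) \<le> 0"
      using nearest_imp_orthogonal_le_0 [OF z2(1) z1(1) N, of x2] near(2) z2(2) by simp
    ultimately have opt2: "0 \<le> (x2 - y2) \<bullet> (b + 2 *\<^sub>R pair_product d)"
      by (simp only: inner_minus_right neg_le_0_iff_le)
    have "norm (z - z1) < \<delta>" "norm (z - z2) < \<delta>"
      using z1(1) z2(1) by (simp_all add: dist_norm)
    moreover from this have nd: "norm d \<le> 2 * \<delta>"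
      using norm_triangle_ineq4 [of "z - z1" "z - z2"] by (simp add: d_def)
    ultimately have "C * norm (z - z1) * norm d \<le> C * \<delta> * norm d"
      using C by (intro mult_right_mono mult_left_mono) auto
    then have "norm (pair_product_deriv (z - z1) d) \<le> C * \<delta> * norm d"
      using norm_pair_product_deriv_le [OF fst_tangent_triples [OF eT] fst_tangent_triples [OF dT]]
      by (simp only: C_def)
    moreover have "C * \<delta> * norm d \<le> c * norm d"
      using \<delta>(3) C \<delta>(1) c by (intro mult_right_mono) auto
    moreover have "norm (pair_product_deriv z d) \<le> norm b + norm (pair_product_deriv (z - z1) d)"
      using norm_triangle_ineq [of b "pair_product_deriv (z - z1) d"]
      by (simp add: b_def flip: pair_product_deriv_diff)
    ultimately have lower: "c * norm d \<le> norm b"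
      using c0(2) [OF dT] by (simp add: c_def)
    have quad: "norm (pair_product d) \<le> C * (norm d * norm d)"
      using norm_pair_product_le [OF fst_tangent_triples [OF dT]] by (simp add: C_def power2_eq_square)
    also have "\<dots> \<le> C * (2 * \<delta> * norm d)"
      using nd C by (intro mult_left_mono mult_right_mono) auto
    also have "\<dots> = 2 * (C * \<delta>) * norm d" by simp
    also have "\<dots> \<le> c / 4 * norm d"
      using \<delta>(3) by (intro mult_right_mono) auto
    also have "\<dots> \<le> norm b / 4" using lower by simp
    finally have small1: "norm (pair_product d) \<le> norm b / 4" .
    have "norm (x2 - y2) \<le> r"
      using lift(2) [OF x(2) near(2)] by (simp add: dist_norm)
    then have "norm (x2 - y2) * norm (pair_product d) \<le> r * (C * (norm d * norm d))"
      using quad r(1) by (intro mult_mono) auto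
    also have "\<dots> = (C * r) * (norm d * norm d)" by simp
    also have "\<dots> \<le> c\<^sup>2 / 8 * (norm d * norm d)"
      using r(3) by (intro mult_right_mono) auto
    also have "\<dots> = (c * norm d)\<^sup>2 / 8" by (simp add: power2_eq_square)
    also have "\<dots> \<le> (norm b)\<^sup>2 / 8"
      using lower c by (intro divide_right_mono power_mono) auto
    finally have small2: "norm (x2 - y2) * norm (pair_product d) \<le> (norm b)\<^sup>2 / 8" .
    have "c * norm d \<le> 2 * norm (x1 - x2)"
      using nearest_points_stable [OF y2 opt1 opt2 small1 small2] lower by linarith
    then have "dist z1 z2 \<le> 2 / c * dist x1 x2"
      using c by (simp add: d_def dist_norm norm_minus_commute [of z1] field_simps)
    with z1 z2 show "\<exists>z1\<in>?M. \<exists>z2\<in>?M. pair_product z1 = y1 \<and> pair_product z2 = y2 \<and> dist z1 z2 \<le> 2 / c * dist x1 x2"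
      by blast
  qed (use r c in simp_all)
qed

section \<open>Numerical GCDs\<close>
lemma pairs_vec_in_stratum [simp]: "pairs_vec x \<in> stratum m n k \<longleftrightarrow> x \<in> gcd_stratum m n k"
  by (simp add: stratum_def)

lemma triple_norm_diff:
  "triple_norm ((poly_of u, poly_of v, poly_of w) - (poly_of u', poly_of v', poly_of w'))
     = dist (u, v, w) (u', v', w')"
  by (simp add: triple_norm_def dist_norm norm_prod_def norm_cpoly.rep_eq add.assoc)

lemma stratum_dist_le:
  assumes "y \<in> gcd_stratum m n k"
  shows "stratum_dist m n k x \<le> dist (pairs_vec x) (pairs_vec y)"
  unfolding stratum_dist_def pair_norm_diff
  by (rule cINF_lower [OF _ assms]) (auto intro: bdd_belowI2 [of _ 0])

lemma stratum_dist_ge: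
  assumes "k \<le> m" "k \<le> n"
    and "\<And>y. y \<in> gcd_stratum m n k \<Longrightarrow> r \<le> dist (pairs_vec x) (pairs_vec y)"
  shows "r \<le> stratum_dist m n k x"
  unfolding stratum_dist_def pair_norm_diff
  by (rule cINF_greatest [OF gcd_stratum_nonempty]) (use assms in auto)

lemma nearest_in_stratum_iff:
  "nearest (stratum m n k) (pairs_vec x) (pairs_vec y) \<longleftrightarrow>
     y \<in> gcd_stratum m n k \<and> pair_norm (y - x) = stratum_dist m n k x"
  (is "?near \<longleftrightarrow> ?dist")
proof
  assume near: ?near
  then have y: "y \<in> gcd_stratum m n k" by (simp add: nearest_def)
  have "dist (pairs_vec x) (pairs_vec y) \<le> stratum_dist m n k x"
  proof (rule stratum_dist_ge [OF gcd_stratum_le_min [OF y]])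
    fix y' assume "y' \<in> gcd_stratum m n k"
    then show "dist (pairs_vec x) (pairs_vec y) \<le> dist (pairs_vec x) (pairs_vec y')"
      using near by (simp add: nearest_def)
  qed
  with stratum_dist_le [OF y, of x] y show ?dist
    by (simp add: pair_norm_diff dist_commute)
next
  assume dist: ?dist
  have "dist (pairs_vec x) (pairs_vec y) \<le> dist (pairs_vec x) y'" if "y' \<in> stratum m n k" for y'
  proof -
    have "polys_pair y' \<in> gcd_stratum m n k" using that by (simp add: stratum_def)
    from stratum_dist_le [OF this, of x] dist show ?thesis
      by (simp add: pair_norm_diff dist_commute)
  qed
  with dist show ?near by (simp add: nearest_def)
qed

text \<open>The stratum of degree \<open>k\<close> is closer than \<open>\<epsilon>\<close> to \<open>x\<close> because it contains \<open>y\<close>; the higher strata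
  keep distance at least \<open>\<epsilon>\<close> from \<open>x\<close> by the triangle inequality.\<close>
lemma num_gcd_degree_eq:
  assumes y: "y \<in> gcd_stratum m n k"
    and away: "\<And>j y'. k < j \<Longrightarrow> y' \<in> stratum m n j \<Longrightarrow> 2 * \<epsilon> \<le> dist (pairs_vec y) y'"
    and x: "pair_norm (x - y) < \<epsilon>"
  shows "num_gcd_degree m n \<epsilon> x = k"
  unfolding num_gcd_degree_def
proof (rule Max_eqI)
  show "finite {j. j \<le> min m n \<and> stratum_dist m n j x < \<epsilon>}" by simp
  show "k \<in> {j. j \<le> min m n \<and> stratum_dist m n j x < \<epsilon>}"
    using gcd_stratum_le_min [OF y] stratum_dist_le [OF y, of x] x by (simp add: pair_norm_diff)
next
  fix j assume j: "j \<in> {j. j \<le> min m n \<and> stratum_dist m n j x < \<epsilon>}"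
  show "j \<le> k"
  proof (rule ccontr)
    assume "\<not> j \<le> k"
    have "\<epsilon> \<le> stratum_dist m n j x"
    proof (rule stratum_dist_ge)
      fix y' assume "y' \<in> gcd_stratum m n j"
      then have "2 * \<epsilon> \<le> dist (pairs_vec y) (pairs_vec y')"
        using \<open>\<not> j \<le> k\<close> by (intro away [of j]) simp_all
      then show "\<epsilon> \<le> dist (pairs_vec x) (pairs_vec y')"
        using x dist_triangle2 [of "pairs_vec y" "pairs_vec y'" "pairs_vec x"]
          dist_commute [of "pairs_vec x" "pairs_vec y"] dist_commute [of "pairs_vec x" "pairs_vec y'"]
        by (simp add: pair_norm_diff)
    qed (use j in auto)
    with j show False by simp
  qed
qed

lemma cofactor_pairs_pair_product:
  assumes z: "(u, v, w) \<in> monic_triples m n k" and y: "pair_product (u, v, w) \<in> stratum m n k"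
    and near: "polys_pair (pair_product (u, v, w)) \<in> nearest_pairs m n \<epsilon> x"
  shows "poly_of u \<in> num_gcds m n \<epsilon> x" "(poly_of v, poly_of w) \<in> cofactor_pairs m n \<epsilon> x (poly_of u)"
proof -
  have u: "poly_of u \<in> gcds (polys_pair (pair_product (u, v, w)))"
    by (rule in_gcds_pair_product [OF z y])
  with near show "poly_of u \<in> num_gcds m n \<epsilon> x"
    unfolding num_gcds_def by blast
  have "poly_of u \<noteq> 0" using monic_triplesD [OF z] by simp
  then have "poly_of (u * v) div poly_of u = poly_of v" "poly_of (u * w) div poly_of u = poly_of w"
    by simp_all
  moreover have "polys_pair (pair_product (u, v, w)) = (poly_of (u * v), poly_of (u * w))"
    by (simp add: polys_pair_def)
  ultimately show "(poly_of v, poly_of w) \<in> cofactor_pairs m n \<epsilon> x (poly_of u)"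
    using u near unfolding cofactor_pairs_def
    by (intro CollectI exI [of _ "poly_of (u * v)"] exI [of _ "poly_of (u * w)"]) (simp only: simp_thms)
qed

theorem theorem6p2:
  fixes m n :: nat and p_hat q_hat :: "complex poly"
  assumes "(p_hat, q_hat) \<in> pairs_eq m n"
  shows "\<exists>D \<theta>. nbhd_in_pairs m n (p_hat, q_hat) D \<and> D \<subseteq> pairs_eq m n \<and> \<theta> > 0 \<and>
    (\<forall>(p, q) \<in> D. \<forall>\<epsilon>. pair_norm ((p, q) - (p_hat, q_hat)) < \<epsilon> \<and> \<epsilon> < \<theta> \<longrightarrow>
       num_gcds m n \<epsilon> (p, q) \<noteq> {}) \<and>
    (\<forall>(p, q) \<in> D. \<forall>\<epsilon>. pair_norm ((p, q) - (p_hat, q_hat)) < \<epsilon> \<and> \<epsilon> < \<theta> \<longrightarrow>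
       (\<forall>u \<in> num_gcds m n \<epsilon> (p, q). \<forall>u' \<in> num_gcds m n \<epsilon> (p, q). poly_sim u u')) \<and>
    (\<forall>\<epsilon>. 0 < \<epsilon> \<and> \<epsilon> < \<theta> \<longrightarrow> (\<exists>\<alpha>>0.
       \<forall>(p1, q1) \<in> D. \<forall>(p2, q2) \<in> D.
         pair_norm ((p1, q1) - (p_hat, q_hat)) < \<epsilon> \<and>
         pair_norm ((p2, q2) - (p_hat, q_hat)) < \<epsilon> \<longrightarrow>
         (\<exists>u1 \<in> num_gcds m n \<epsilon> (p1, q1). \<exists>u2 \<in> num_gcds m n \<epsilon> (p2, q2).
          \<exists>(v1, w1) \<in> cofactor_pairs m n \<epsilon> (p1, q1) u1.
          \<exists>(v2, w2) \<in> cofactor_pairs m n \<epsilon> (p2, q2) u2.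
            triple_norm ((u1, v1, w1) - (u2, v2, w2))
              \<le> \<alpha> * pair_norm ((p1, q1) - (p2, q2)))))"
proof -
  define k where "k = degree (gcd p_hat q_hat)"
  define h where "h = (p_hat, q_hat)"
  have h: "h \<in> gcd_stratum m n k"
    using assms by (simp add: h_def gcd_stratum_iff k_def)
  then have hS: "pairs_vec h \<in> stratum m n k" by simp
  obtain r1 where r1: "r1 > 0"
    "\<And>y. y \<in> polys_le m \<times> polys_le n \<Longrightarrow> dist (pairs_vec h) y < r1 \<Longrightarrow> polys_pair y \<in> pairs_eq m n"
    "\<And>j y. k < j \<Longrightarrow> y \<in> stratum m n j \<Longrightarrow> r1 \<le> dist (pairs_vec h) y"
    by (rule stratum_near [OF hS]) blast
  obtain r2 where r2: "r2 > 0"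
    "\<And>x. dist (pairs_vec h) x < r2 \<Longrightarrow> \<exists>y. nearest (stratum m n k) x y"
    by (rule nearest_in_stratum_exists [OF hS]) blast
  obtain r3 L where r3: "r3 > 0" "L > 0"
    and lip: "\<And>x1 x2 y1 y2. dist (pairs_vec h) x1 < r3 \<Longrightarrow> dist (pairs_vec h) x2 < r3 \<Longrightarrow>
       nearest (stratum m n k) x1 y1 \<Longrightarrow> nearest (stratum m n k) x2 y2 \<Longrightarrow>
       \<exists>z1\<in>monic_triples m n k. \<exists>z2\<in>monic_triples m n k.
         pair_product z1 = y1 \<and> pair_product z2 = y2 \<and> dist z1 z2 \<le> L * dist x1 x2"
    by (rule nearest_in_stratum_lipschitz [OF hS]) blast
  \<comment> \<open>Half of \<open>r1\<close>: higher strata must keep distance \<open>\<epsilon>\<close> from every pair within \<open>\<epsilon>\<close> of \<open>h\<close>.\<close>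
  define \<theta> where "\<theta> = min (r1 / 2) (min r2 r3)"
  have \<theta>: "\<theta> > 0" "2 * \<theta> \<le> r1" "\<theta> \<le> r2" "\<theta> \<le> r3"
    using r1(1) r2(1) r3(1) by (auto simp: \<theta>_def)
  define D where "D = {x \<in> pairs_le m n. pair_norm (x - h) < \<theta>}"
  have nbhd: "nbhd_in_pairs m n h D"
    using \<theta>(1) by (auto simp: nbhd_in_pairs_def D_def)
  have D_sub: "D \<subseteq> pairs_eq m n"
  proof
    fix x assume x: "x \<in> D"
    have "pairs_vec x \<in> polys_le m \<times> polys_le n"
      using x by (auto simp: D_def pairs_le_def pairs_vec_def)
    moreover have "dist (pairs_vec h) (pairs_vec x) < r1"
      using x \<theta>(1,2) by (simp add: D_def pair_norm_diff dist_commute)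
    ultimately have "polys_pair (pairs_vec x) \<in> pairs_eq m n"
      by (rule r1(2))
    then show "x \<in> pairs_eq m n" by simp
  qed
  have nearest_pairs: "nearest_pairs m n \<epsilon> x = {y. nearest (stratum m n k) (pairs_vec x) (pairs_vec y)}"
    if \<epsilon>: "pair_norm (x - h) < \<epsilon>" "\<epsilon> < \<theta>" for x \<epsilon>
  proof -
    have "num_gcd_degree m n \<epsilon> x = k"
    proof (rule num_gcd_degree_eq [OF h])
      show "2 * \<epsilon> \<le> dist (pairs_vec h) y'" if "k < j" "y' \<in> stratum m n j" for j y'
        using r1(3) [OF that] \<epsilon>(2) \<theta>(2) by linarith
    qed (rule \<epsilon>(1))
    then show ?thesis by (simp add: nearest_pairs_def nearest_in_stratum_iff)
  qed
  have close: "dist (pairs_vec h) (pairs_vec x) < r2" "dist (pairs_vec h) (pairs_vec x) < r3"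
    if "pair_norm (x - h) < \<epsilon>" "\<epsilon> < \<theta>" for x \<epsilon>
    using that \<theta> by (auto simp: pair_norm_diff dist_commute)
  have ex_nearest: "\<exists>y. y \<in> nearest_pairs m n \<epsilon> x \<and> nearest (stratum m n k) (pairs_vec x) (pairs_vec y)"
    if \<epsilon>: "pair_norm (x - h) < \<epsilon>" "\<epsilon> < \<theta>" for x \<epsilon>
  proof -
    obtain y where "nearest (stratum m n k) (pairs_vec x) y"
      using r2(2) [OF close(1) [OF \<epsilon>]] by blast
    then have "nearest (stratum m n k) (pairs_vec x) (pairs_vec (polys_pair y))" by simp
    then show ?thesis using nearest_pairs [OF \<epsilon>] by blast
  qed
  have exist: "num_gcds m n \<epsilon> x \<noteq> {}" if \<epsilon>: "pair_norm (x - h) < \<epsilon>" "\<epsilon> < \<theta>" for x \<epsilon>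
  proof -
    obtain y where y: "y \<in> nearest_pairs m n \<epsilon> x" "nearest (stratum m n k) (pairs_vec x) (pairs_vec y)"
      using ex_nearest [OF \<epsilon>] by blast
    then have "y \<in> gcd_stratum m n k" by (simp add: nearest_def)
    then have "gcds y \<noteq> {}" by (auto simp: gcd_stratum_def)
    with y(1) show ?thesis by (auto simp: num_gcds_def)
  qed
  have unique: "poly_sim u u'"
    if \<epsilon>: "pair_norm (x - h) < \<epsilon>" "\<epsilon> < \<theta>" and u: "u \<in> num_gcds m n \<epsilon> x" "u' \<in> num_gcds m n \<epsilon> x" for x \<epsilon> u u'
  proof -
    obtain y y' where y: "nearest (stratum m n k) (pairs_vec x) (pairs_vec y)" "u \<in> gcds y"
      and y': "nearest (stratum m n k) (pairs_vec x) (pairs_vec y')" "u' \<in> gcds y'"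
      using u nearest_pairs [OF \<epsilon>] by (auto simp: num_gcds_def)
    \<comment> \<open>Applying the Lipschitz estimate to \<open>x1 = x2\<close> identifies the two nearest pairs.\<close>
    have "pairs_vec y = pairs_vec y'"
      using lip [OF close(2) [OF \<epsilon>] close(2) [OF \<epsilon>] y(1) y'(1)] by auto
    then have eq: "y = y'" by (metis polys_pair_pairs_vec)
    obtain p q where pq: "y = (p, q)" by (cases y)
    have "p \<noteq> 0"
      using y(1) by (auto simp: nearest_def pq gcd_stratum_iff pairs_eq_def)
    then show ?thesis
      using y(2) y'(2) eq pq gcds_iff poly_sim_trans [OF _ poly_sim_sym] by blast
  qed
  have lipschitz: "\<exists>u1 \<in> num_gcds m n \<epsilon> x1. \<exists>u2 \<in> num_gcds m n \<epsilon> x2.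
          \<exists>(v1, w1) \<in> cofactor_pairs m n \<epsilon> x1 u1. \<exists>(v2, w2) \<in> cofactor_pairs m n \<epsilon> x2 u2.
            triple_norm ((u1, v1, w1) - (u2, v2, w2)) \<le> L * pair_norm (x1 - x2)"
    if \<epsilon>: "\<epsilon> < \<theta>" and x: "pair_norm (x1 - h) < \<epsilon>" "pair_norm (x2 - h) < \<epsilon>" for x1 x2 \<epsilon>
  proof -
    obtain y1 where y1: "y1 \<in> nearest_pairs m n \<epsilon> x1" "nearest (stratum m n k) (pairs_vec x1) (pairs_vec y1)"
      using ex_nearest [OF x(1) \<epsilon>] by blast
    obtain y2 where y2: "y2 \<in> nearest_pairs m n \<epsilon> x2" "nearest (stratum m n k) (pairs_vec x2) (pairs_vec y2)"
      using ex_nearest [OF x(2) \<epsilon>] by blast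
    obtain z1 z2 where z: "z1 \<in> monic_triples m n k" "z2 \<in> monic_triples m n k"
      "pair_product z1 = pairs_vec y1" "pair_product z2 = pairs_vec y2"
      "dist z1 z2 \<le> L * dist (pairs_vec x1) (pairs_vec x2)"
      using lip [OF close(2) [OF x(1) \<epsilon>] close(2) [OF x(2) \<epsilon>] y1(2) y2(2)] by blast
    obtain u1 v1 w1 where uvw1: "z1 = (u1, v1, w1)" by (cases z1)
    obtain u2 v2 w2 where uvw2: "z2 = (u2, v2, w2)" by (cases z2)
    have S: "pairs_vec y1 \<in> stratum m n k" "pairs_vec y2 \<in> stratum m n k"
      using y1(2) y2(2) unfolding nearest_def by blast+
    have m1: "poly_of u1 \<in> num_gcds m n \<epsilon> x1" "(poly_of v1, poly_of w1) \<in> cofactor_pairs m n \<epsilon> x1 (poly_of u1)"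
      using cofactor_pairs_pair_product [of u1 v1 w1 m n k \<epsilon> x1] z(1,3) S(1) y1(1)
      unfolding uvw1 by simp_all
    have m2: "poly_of u2 \<in> num_gcds m n \<epsilon> x2" "(poly_of v2, poly_of w2) \<in> cofactor_pairs m n \<epsilon> x2 (poly_of u2)"
      using cofactor_pairs_pair_product [of u2 v2 w2 m n k \<epsilon> x2] z(2,4) S(2) y2(1)
      unfolding uvw2 by simp_all
    have "triple_norm ((poly_of u1, poly_of v1, poly_of w1) - (poly_of u2, poly_of v2, poly_of w2))
        \<le> L * pair_norm (x1 - x2)"
      using z(5) unfolding uvw1 uvw2 triple_norm_diff pair_norm_diff .
    then show ?thesis
      by (intro bexI [OF _ m1(1)] bexI [OF _ m2(1)] bexI [OF _ m1(2)] bexI [OF _ m2(2)] case_prodI)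
  qed
  show ?thesis
  proof (intro exI [of _ D] exI [of _ \<theta>] conjI)
    show "nbhd_in_pairs m n (p_hat, q_hat) D" "D \<subseteq> pairs_eq m n" "\<theta> > 0"
      using nbhd D_sub \<theta>(1) by (simp_all add: h_def)
  qed ((intro ballI case_prodI2 allI impI exI [of _ L] conjI r3(2), (elim conjE)?,
        rule exist [unfolded h_def] unique [unfolded h_def] lipschitz [unfolded h_def]; assumption)+)
qed

end
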